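(* There is a trivial computable probability measure $\mu$ on $2^\omega$ such that (i) $\mathsf{W2R}_\mu=\mathsf{Atoms}_\mu$, and (ii) $\mathsf{MLR}_\mu\setminus\mathsf{W2R}_\mu\neq\emptyset$.
   Context: $2^\omega$ is Cantor space (infinite binary sequences), $2^{<\omega}$ the set of finite binary strings, and $[\![\sigma]\!]$ the set of $X\in 2^\omega$ extending $\sigma$. A probability measure $\mu$ on $2^\omega$ is computable if $\sigma\mapsto\mu([\![\sigma]\!])$ is a computable real-valued function, i.e. there is a computable function $\widehat\mu:2^{<\omega}\times\omega\to\mathbb{Q}_2$ (dyadic rationals) with $|\mu([\![\sigma]\!])-\widehat\mu(\sigma,i)|\le 2^{-i}$ for all $\sigma,i$. $\mathsf{Atoms}_\mu=\{A\in 2^\omega:\mu(\{A\})>0\}$, and $\mu$ is trivial if $\mu(\mathsf{Atoms}_\mu)=1$. A $\mu$-Martin-Löf test is a sequence $(\mathcal U_i)_{i\in\omega}$ of uniformly effectively open ($\Sigma^0_1$) subsets of $2^\omega$ with $\mu(\mathcal U_i)\le 2^{-i}$ for all $i$; a generalized $\mu$-Martin-Löf test is a sequence of uniformly effectively open sets with $\lim_{i\to\infty}\mu(\mathcal U_i)=0$. $\mathsf{MLR}_\mu$ (the $\mu$-Martin-Löf random sequences) is the set of $X$ with $X\notin\bigcap_i\mathcal U_i$ for every $\mu$-Martin-Löf test, and $\mathsf{W2R}_\mu$ (the $\mu$-weakly 2-random sequences) is the set of $X$ with $X\notin\bigcap_i\mathcal U_i$ for every generalized $\mu$-Martin-Löf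 test. *)

theory Defs
  imports "HOL-Probability.Probability" "HOL-Library.Nat_Bijection"
begin

section \<open>Partial recursive functions\<close>

text \<open>
  The partial recursive functions, presented as unary functions; several arguments are
  passed through the pairing bijection \<^const>\<open>prod_encode\<close>. The closure conditions are
  the usual initial functions, pairing, composition, primitive recursion and minimization
  (the minimization of \<open>f\<close> at \<open>a\<close> is defined iff \<open>f\<close> has a zero at some \<open>(a, n)\<close>
  and is defined at all \<open>(a, m)\<close> with \<open>m < n\<close>).
\<close>

definition prim_recursion :: "(nat \<rightharpoonup> nat) \<Rightarrow> (nat \<rightharpoonup> nat) \<Rightarrow> (nat \<rightharpoonup> nat)" where
  "prim_recursion f g = (\<lambda>x. case prod_decode x of (a, n) \<Rightarrow>
     rec_nat (f a)
       (\<lambda>k r. Option.bind r (\<lambda>v. g (prod_encode (a, prod_encode (k, v))))) n)"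

definition minimization :: "(nat \<rightharpoonup> nat) \<Rightarrow> (nat \<rightharpoonup> nat)" where
  "minimization f = (\<lambda>a.
     let halts_at = (\<lambda>n. f (prod_encode (a, n)) = Some 0 \<and>
                         (\<forall>m<n. \<exists>v>0. f (prod_encode (a, m)) = Some v))
     in if \<exists>n. halts_at n then Some (THE n. halts_at n) else None)"

inductive partial_recursive :: "(nat \<rightharpoonup> nat) \<Rightarrow> bool" where
  zero: "partial_recursive (\<lambda>x. Some 0)"
| succ: "partial_recursive (\<lambda>x. Some (Suc x))"
| proj1: "partial_recursive (\<lambda>x. Some (fst (prod_decode x)))"
| proj2: "partial_recursive (\<lambda>x. Some (snd (prod_decode x)))"
| pair: "partial_recursive f \<Longrightarrow> partial_recursive g \<Longrightarrow>
    partial_recursive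
      (\<lambda>x. Option.bind (f x) (\<lambda>a. Option.bind (g x) (\<lambda>b. Some (prod_encode (a, b)))))"
| comp: "partial_recursive f \<Longrightarrow> partial_recursive g \<Longrightarrow>
    partial_recursive (\<lambda>x. Option.bind (g x) f)"
| prec: "partial_recursive f \<Longrightarrow> partial_recursive g \<Longrightarrow>
    partial_recursive (prim_recursion f g)"
| mu: "partial_recursive f \<Longrightarrow> partial_recursive (minimization f)"

definition total_recursive :: "(nat \<Rightarrow> nat) \<Rightarrow> bool" where
  "total_recursive f \<longleftrightarrow> partial_recursive (\<lambda>x. Some (f x))"

definition comp_enumerable :: "nat set \<Rightarrow> bool" where
  "comp_enumerable A \<longleftrightarrow> (\<exists>f. partial_recursive f \<and> A = dom f)"

section \<open>Cantor space and computable measures\<close>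

type_synonym cantor = "nat \<Rightarrow> bool"

definition cylinder :: "bool list \<Rightarrow> cantor set" where
  "cylinder \<sigma> = {X. \<forall>i<length \<sigma>. X i = \<sigma> ! i}"

lemma open_cylinder: "open (cylinder \<sigma>)"
proof -
  have "cylinder \<sigma> = (\<Inter>i\<in>{..<length \<sigma>}. (\<lambda>X. X i) -` {\<sigma> ! i})"
    by (auto simp: cylinder_def)
  moreover have "open ((\<lambda>X::cantor. X i) -` {b})" for i b
    by (intro open_vimage Topological_Spaces.open_discrete continuous_on_product_coordinates)
  ultimately show ?thesis
    by (auto intro!: open_INT)
qed

instance bool :: second_countable_topology
proof
  have "(open :: bool set \<Rightarrow> bool) = generate_topology UNIV"
    by (auto simp: fun_eq_iff Topological_Spaces.open_discrete intro: generate_topology.Basis)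
  then show "\<exists>B :: bool set set. countable B \<and> open = generate_topology B"
    by (intro exI[of _ UNIV]) (auto intro: countable_finite)
qed

lemma sets_borel_cantor:
  "sets (borel :: cantor measure) = sets (\<Pi>\<^sub>M i\<in>UNIV. count_space UNIV)"
proof -
  have "sets (borel :: bool measure) = sets (count_space UNIV)"
    by (auto intro!: borel_open Topological_Spaces.open_discrete)
  then show ?thesis
    by (subst sets_PiM_equal_borel[symmetric]) (intro sets_PiM_cong refl)
qed

definition string_code :: "bool list \<Rightarrow> nat" where
  "string_code \<sigma> = list_encode (map of_bool \<sigma>)"

lemma inj_string_code: "inj string_code"
proof (rule injI)
  fix \<sigma> \<tau> assume "string_code \<sigma> = string_code \<tau>"
  hence "map (of_bool :: bool \<Rightarrow> nat) \<sigma> = map of_bool \<tau>"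
    by (metis string_code_def list_encode_inverse)
  moreover have "inj (of_bool :: bool \<Rightarrow> nat)"
    by (auto simp: inj_def)
  ultimately show "\<sigma> = \<tau>"
    by (metis inj_map_eq_map)
qed

text \<open>The number coded by \<open>(k, e)\<close> is \<open>z / 2 ^ e\<close>, where the integer \<open>z\<close> has code \<open>k\<close>;
  this ranges over exactly the dyadic rationals.\<close>

definition dyadic_of_code :: "nat \<Rightarrow> real" where
  "dyadic_of_code c = (case prod_decode c of (k, e) \<Rightarrow> of_int (int_decode k) / 2 ^ e)"

definition computable_dyadic_valued :: "(bool list \<Rightarrow> nat \<Rightarrow> real) \<Rightarrow> bool" where
  "computable_dyadic_valued q \<longleftrightarrow>
     (\<exists>f. total_recursive f \<and>
          (\<forall>\<sigma> i. q \<sigma> i = dyadic_of_code (f (prod_encode (string_code \<sigma>, i)))))"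

definition computable_measure :: "cantor measure \<Rightarrow> bool" where
  "computable_measure \<mu> \<longleftrightarrow>
     (\<exists>q. computable_dyadic_valued q \<and>
          (\<forall>\<sigma> i. \<bar>measure \<mu> (cylinder \<sigma>) - q \<sigma> i\<bar> \<le> (1 / 2) ^ i))"

definition Atoms :: "cantor measure \<Rightarrow> cantor set" where
  "Atoms \<mu> = {A. measure \<mu> {A} > 0}"

definition trivial_measure :: "cantor measure \<Rightarrow> bool" where
  "trivial_measure \<mu> \<longleftrightarrow> measure \<mu> (Atoms \<mu>) = 1"

section \<open>Randomness\<close>

definition uniformly_effectively_open :: "(nat \<Rightarrow> cantor set) \<Rightarrow> bool" where
  "uniformly_effectively_open U \<longleftrightarrow>
     (\<exists>W :: (nat \<times> bool list) set.
        comp_enumerable ((\<lambda>(i, \<sigma>). prod_encode (i, string_code \<sigma>)) ` W) \<and>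
        (\<forall>i. U i = (\<Union>\<sigma>\<in>{\<sigma>. (i, \<sigma>) \<in> W}. cylinder \<sigma>)))"

definition martin_lof_test :: "cantor measure \<Rightarrow> (nat \<Rightarrow> cantor set) \<Rightarrow> bool" where
  "martin_lof_test \<mu> U \<longleftrightarrow> uniformly_effectively_open U \<and> (\<forall>i. measure \<mu> (U i) \<le> (1 / 2) ^ i)"

definition generalized_martin_lof_test :: "cantor measure \<Rightarrow> (nat \<Rightarrow> cantor set) \<Rightarrow> bool" where
  "generalized_martin_lof_test \<mu> U \<longleftrightarrow>
     uniformly_effectively_open U \<and> (\<lambda>i. measure \<mu> (U i)) \<longlonglongrightarrow> 0"

definition MLR :: "cantor measure \<Rightarrow> cantor set" where
  "MLR \<mu> = {X. \<forall>U. martin_lof_test \<mu> U \<longrightarrow> X \<notin> (\<Inter>i. U i)}"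

definition W2R :: "cantor measure \<Rightarrow> cantor set" where
  "W2R \<mu> = {X. \<forall>U. generalized_martin_lof_test \<mu> U \<longrightarrow> X \<notin> (\<Inter>i. U i)}"

end

theory Submission
  imports Defs "HOL-Library.Discrete_Functions"
begin

text \<open>
  The measure is carried by a sequence of point masses that converges to a single point \<open>Y\<close>
  of measure zero. On every level of the binary tree exactly one node splits its mass between
  its children; every other node passes all its mass to its right child. The splitting node is
  the leftmost node of positive mass that is not yet seen to be covered by the \<open>(e + 2)\<close>-nd
  component of an \<open>e\<close>-th c.e. test, where a test is heeded only as long as that component is
  seen to have measure at most \<open>(1/2)^(e+2)\<close>. The components cover at most half of the mass, so the
  splitting nodes, which only move to the right, converge to some \<open>Y\<close> avoiding every
  Martin-Loef test. A point of the support passes either finitely many splitting nodes, and then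
  it is an atom, or infinitely many, and then it is \<open>Y\<close>. The open sets of all points passing a
  splitting node of code at least \<open>i\<close> shrink to \<open>{Y}\<close>, so \<open>Y\<close> is not weakly 2-random.
\<close>

section \<open>Closure properties of total recursive functions\<close>

text \<open>Two obstacles shape the construction. Whether a program enumerates a test is
  undecidable, and whether it respects its bound depends on the measure being built. Hence every
  program is heeded provisionally, and a splitting decision uses only masses already fixed by the
  levels above; these are exact dyadic numbers, so the comparison is decidable and the measure
  computable. A program that later overspends has cost no more than its budget: coverage only grows,
  so all it blocked up to a level lies in what it covers at the last level within budget. Having one
  splitting node per level does double duty: infinitely many lie on \<open>Y\<close>, so
  \<open>Y\<close> is null, and no other path meets infinitely many. The sets capturing
  \<open>Y\<close> have measure tending to 0 at no computable rate, because the splitting nodes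
  settle only in the limit; this is consistent with \<open>Y\<close> avoiding every Martin-Loef
  test.\<close>

abbreviation pfst :: "nat \<Rightarrow> nat" where "pfst x \<equiv> fst (prod_decode x)"
abbreviation psnd :: "nat \<Rightarrow> nat" where "psnd x \<equiv> snd (prod_decode x)"

definition decidable :: "(nat \<Rightarrow> bool) \<Rightarrow> bool" where
  "decidable P \<longleftrightarrow> total_recursive (\<lambda>x. of_bool (P x))"

text \<open>The rules are stated pointwise so that \<open>intro\<close> descends through a term;
  dependence on a parameter and a bound variable is expressed on the code of the pair.\<close>

named_theorems recursive_intros

lemma total_recursive_compose:
  assumes "total_recursive f" "total_recursive g"
  shows "total_recursive (\<lambda>x. f (g x))"
  using partial_recursive.comp[OF assms[unfolded total_recursive_def]]
  by (simp add: total_recursive_def)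

lemma total_recursive_prod_encode [recursive_intros]:
  assumes "total_recursive f" "total_recursive g"
  shows "total_recursive (\<lambda>x. prod_encode (f x, g x))"
  using partial_recursive.pair[OF assms[unfolded total_recursive_def]]
  by (simp add: total_recursive_def)

lemma total_recursive_pfst [recursive_intros]:
  "total_recursive f \<Longrightarrow> total_recursive (\<lambda>x. pfst (f x))"
  by (rule total_recursive_compose[of pfst])
     (simp_all add: total_recursive_def partial_recursive.proj1)

lemma total_recursive_psnd [recursive_intros]:
  "total_recursive f \<Longrightarrow> total_recursive (\<lambda>x. psnd (f x))"
  by (rule total_recursive_compose[of psnd])
     (simp_all add: total_recursive_def partial_recursive.proj2)

lemma total_recursive_Suc [recursive_intros]:
  "total_recursive f \<Longrightarrow> total_recursive (\<lambda>x. Suc (f x))"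
  by (rule total_recursive_compose[of Suc])
     (simp_all add: total_recursive_def partial_recursive.succ)

lemma total_recursive_id [recursive_intros]: "total_recursive (\<lambda>x. x)"
  using total_recursive_prod_encode[OF total_recursive_pfst total_recursive_psnd, of id id]
    partial_recursive.proj1 partial_recursive.proj2
    partial_recursive.pair[OF partial_recursive.proj1 partial_recursive.proj2]
  by (simp add: total_recursive_def)

lemma total_recursive_const [recursive_intros]: "total_recursive (\<lambda>x. c)"
proof (induction c)
  case 0
  show ?case by (simp add: total_recursive_def partial_recursive.zero)
next
  case (Suc c)
  then show ?case by (rule total_recursive_Suc)
qed

text \<open>The step function may depend on the parameter, so it is presented on codes of triples
  (parameter, counter, value), the argument format of \<open>prim_recursion\<close>.\<close>

lemma total_recursive_rec_nat [recursive_intros]: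
  assumes "total_recursive f" "total_recursive n"
    and g: "total_recursive (\<lambda>z. g (pfst z) (pfst (psnd z)) (psnd (psnd z)))"
  shows "total_recursive (\<lambda>x. rec_nat (f x) (g x) (n x))"
proof -
  let ?g = "\<lambda>z. g (pfst z) (pfst (psnd z)) (psnd (psnd z))"
  have "partial_recursive (prim_recursion (\<lambda>x. Some (f x)) (\<lambda>x. Some (?g x)))"
    using assms by (intro partial_recursive.prec) (simp_all add: total_recursive_def)
  moreover have "rec_nat (Some (f a))
      (\<lambda>k r. Option.bind r (\<lambda>v. Some (?g (prod_encode (a, prod_encode (k, v)))))) m
      = Some (rec_nat (f a) (g a) m)" for a m
    by (induction m) auto
  ultimately have "total_recursive (\<lambda>z. rec_nat (f (pfst z)) (g (pfst z)) (psnd z))"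
    by (simp add: prim_recursion_def total_recursive_def case_prod_beta)
  then show ?thesis
    using total_recursive_compose[OF _ total_recursive_prod_encode[OF total_recursive_id assms(2)]]
    by fastforce
qed

lemma total_recursive_add [recursive_intros]:
  assumes "total_recursive f" "total_recursive g"
  shows "total_recursive (\<lambda>x. f x + g x)"
proof -
  have "total_recursive (\<lambda>x. rec_nat (f x) (\<lambda>k v. Suc v) (g x))"
    by (intro recursive_intros assms)
  moreover have "rec_nat a (\<lambda>k v. Suc v) b = a + b" for a b :: nat
    by (induction b) auto
  ultimately show ?thesis by simp
qed

lemma total_recursive_mult [recursive_intros]:
  assumes "total_recursive f" "total_recursive g"
  shows "total_recursive (\<lambda>x. f x * g x)"
proof -
  have "total_recursive (\<lambda>x. rec_nat 0 (\<lambda>k v. v + f x) (g x))"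
    by (intro recursive_intros assms) (rule total_recursive_compose[OF assms(1)], intro recursive_intros)
  moreover have "rec_nat 0 (\<lambda>k v. v + a) b = a * b" for a b :: nat
    by (induction b) auto
  ultimately show ?thesis by simp
qed

lemma total_recursive_power [recursive_intros]:
  assumes "total_recursive f" "total_recursive g"
  shows "total_recursive (\<lambda>x. f x ^ g x)"
proof -
  have "total_recursive (\<lambda>x. rec_nat 1 (\<lambda>k v. v * f x) (g x))"
    by (intro recursive_intros assms) (rule total_recursive_compose[OF assms(1)], intro recursive_intros)
  moreover have "rec_nat 1 (\<lambda>k v. v * a) b = a ^ b" for a b :: nat
    by (induction b) auto
  ultimately show ?thesis by simp
qed

lemma total_recursive_diff [recursive_intros]:
  assumes "total_recursive f" "total_recursive g"
  shows "total_recursive (\<lambda>x. f x - g x)"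
proof -
  have "total_recursive (\<lambda>x. rec_nat 0 (\<lambda>k v. k) x)"
    by (intro recursive_intros)
  moreover have "rec_nat 0 (\<lambda>k v. k) x = x - 1" for x :: nat
    by (cases x) auto
  ultimately have pred: "total_recursive (\<lambda>x. x - 1)" by simp
  have "total_recursive (\<lambda>x. rec_nat (f x) (\<lambda>k v. v - 1) (g x))"
    by (intro recursive_intros assms) (rule total_recursive_compose[OF pred], intro recursive_intros)
  moreover have "rec_nat a (\<lambda>k v. v - 1) b = a - b" for a b :: nat
    by (induction b) auto
  ultimately show ?thesis by simp
qed

lemma total_recursive_sum [recursive_intros]:
  assumes "total_recursive n" "total_recursive (\<lambda>z. f (pfst z) (psnd z))"
  shows "total_recursive (\<lambda>x. \<Sum>k<n x. f x k)"
proof -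
  have "total_recursive (\<lambda>z. f (pfst z) (pfst (psnd z)))"
    using total_recursive_compose[OF assms(2),
        of "\<lambda>z. prod_encode (pfst z, pfst (psnd z))"]
    by (simp add: recursive_intros)
  then have "total_recursive (\<lambda>x. rec_nat 0 (\<lambda>k v. v + f x k) (n x))"
    by (intro recursive_intros assms)
  moreover have "rec_nat 0 (\<lambda>k v. v + h k) m = (\<Sum>k<m. h k)" for h :: "nat \<Rightarrow> nat" and m
    by (induction m) auto
  ultimately show ?thesis by simp
qed

section \<open>Decidable predicates and bounded search\<close>

lemma total_recursive_of_bool [recursive_intros]:
  "decidable P \<Longrightarrow> total_recursive (\<lambda>x. of_bool (P x))"
  by (simp add: decidable_def)

lemma decidable_compose:
  "decidable P \<Longrightarrow> total_recursive f \<Longrightarrow> decidable (\<lambda>x. P (f x))"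
  using total_recursive_compose[of "\<lambda>x. of_bool (P x)" f] by (simp add: decidable_def)

lemma total_recursive_compose2:
  assumes "total_recursive (\<lambda>z. F (pfst z) (psnd z))" "total_recursive f" "total_recursive g"
  shows "total_recursive (\<lambda>x. F (f x) (g x))"
  using total_recursive_compose[OF assms(1) total_recursive_prod_encode[OF assms(2,3)]] by simp

lemma decidable_compose2:
  assumes "decidable (\<lambda>z. P (pfst z) (psnd z))" "total_recursive f" "total_recursive g"
  shows "decidable (\<lambda>x. P (f x) (g x))"
  using decidable_compose[OF assms(1) total_recursive_prod_encode[OF assms(2,3)]] by simp

lemma decidable_not [recursive_intros]: "decidable P \<Longrightarrow> decidable (\<lambda>x. \<not> P x)"
proof -
  assume "decidable P"
  then have "total_recursive (\<lambda>x. 1 - of_bool (P x))"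
    by (intro recursive_intros)
  moreover have "1 - of_bool b = (of_bool (\<not> b) :: nat)" for b
    by simp
  ultimately show ?thesis
    by (simp only: decidable_def)
qed

lemma decidable_conj [recursive_intros]:
  "decidable P \<Longrightarrow> decidable Q \<Longrightarrow> decidable (\<lambda>x. P x \<and> Q x)"
proof -
  assume "decidable P" "decidable Q"
  then have "total_recursive (\<lambda>x. of_bool (P x) * of_bool (Q x))"
    by (intro recursive_intros)
  then show ?thesis
    by (simp add: decidable_def of_bool_conj)
qed

lemma decidable_disj [recursive_intros]:
  "decidable P \<Longrightarrow> decidable Q \<Longrightarrow> decidable (\<lambda>x. P x \<or> Q x)"
  using decidable_not[OF decidable_conj[OF decidable_not[of P] decidable_not[of Q]]] by simp

lemma decidable_imp [recursive_intros]:
  "decidable P \<Longrightarrow> decidable Q \<Longrightarrow> decidable (\<lambda>x. P x \<longrightarrow> Q x)"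
  using decidable_disj[OF decidable_not[of P], of Q] unfolding imp_conv_disj .

lemma decidable_eq_0:
  assumes "total_recursive f"
  shows "decidable (\<lambda>x. f x = 0)"
proof -
  have "total_recursive (\<lambda>x. 1 - f x)" by (intro recursive_intros assms)
  moreover have "1 - f x = of_bool (f x = 0)" for x by simp
  ultimately show ?thesis by (simp add: decidable_def)
qed

lemma decidable_le [recursive_intros]:
  assumes "total_recursive f" "total_recursive g"
  shows "decidable (\<lambda>x. f x \<le> g x)"
  using decidable_eq_0[OF total_recursive_diff[OF assms]] by simp

lemma decidable_less [recursive_intros]:
  assumes "total_recursive f" "total_recursive g"
  shows "decidable (\<lambda>x. f x < g x)"
  using decidable_not[OF decidable_le[OF assms(2,1)]] by (simp add: not_le)

lemma decidable_eq [recursive_intros]: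
  assumes "total_recursive f" "total_recursive g"
  shows "decidable (\<lambda>x. f x = g x)"
  using decidable_conj[OF decidable_le[OF assms] decidable_le[OF assms(2,1)]]
  unfolding order_eq_iff .

lemma decidable_all_less [recursive_intros]:
  assumes "total_recursive n" "decidable (\<lambda>z. P (pfst z) (psnd z))"
  shows "decidable (\<lambda>x. \<forall>k<n x. P x k)"
proof -
  have "decidable (\<lambda>x. (\<Sum>k<n x. of_bool (\<not> P x k)) = (0::nat))"
    by (intro recursive_intros assms)
  moreover have "(\<Sum>k<n x. of_bool (\<not> P x k)) = (0::nat) \<longleftrightarrow> (\<forall>k<n x. P x k)" for x
    by (auto split: if_splits)
  ultimately show ?thesis by simp
qed

lemma decidable_ex_less [recursive_intros]:
  assumes "total_recursive n" "decidable (\<lambda>z. P (pfst z) (psnd z))"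
  shows "decidable (\<lambda>x. \<exists>k<n x. P x k)"
  using decidable_not[OF decidable_all_less[OF assms(1) decidable_not[OF assms(2)]]] by simp

lemma decidable_all_le [recursive_intros]:
  assumes "total_recursive n" "decidable (\<lambda>z. P (pfst z) (psnd z))"
  shows "decidable (\<lambda>x. \<forall>k\<le>n x. P x k)"
  using decidable_all_less[OF total_recursive_Suc[OF assms(1)] assms(2)] by (simp add: less_Suc_eq_le)

lemma decidable_ex_le [recursive_intros]:
  assumes "total_recursive n" "decidable (\<lambda>z. P (pfst z) (psnd z))"
  shows "decidable (\<lambda>x. \<exists>k\<le>n x. P x k)"
  using decidable_ex_less[OF total_recursive_Suc[OF assms(1)] assms(2)] by (simp add: less_Suc_eq_le)

lemma total_recursive_if [recursive_intros]:
  assumes "decidable P" "total_recursive f" "total_recursive g"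
  shows "total_recursive (\<lambda>x. if P x then f x else g x)"
proof -
  have "total_recursive (\<lambda>x. of_bool (P x) * f x + of_bool (\<not> P x) * g x)"
    by (intro recursive_intros assms)
  moreover have "of_bool (P x) * f x + of_bool (\<not> P x) * g x = (if P x then f x else g x)" for x
    by simp
  ultimately show ?thesis by simp
qed

lemma total_recursive_div [recursive_intros]:
  assumes "total_recursive f" "total_recursive g"
  shows "total_recursive (\<lambda>x. f x div g x)"
proof -
  have "total_recursive (\<lambda>z. f (pfst z))" "total_recursive (\<lambda>z. g (pfst z))"
    using assms[THEN total_recursive_compose, OF total_recursive_pfst[OF total_recursive_id]]
    by auto
  \<comment> \<open>The quotient counts the positive multiples of the divisor up to the dividend;
    \<open>0 < g x\<close> makes division by zero give 0, as in HOL.\<close>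
  then have "total_recursive (\<lambda>x. \<Sum>k<f x. of_bool (0 < g x \<and> Suc k * g x \<le> f x))"
    by (intro recursive_intros assms)
  moreover have "(\<Sum>k<a. of_bool (0 < b \<and> Suc k * b \<le> a)) = a div b" for a b :: nat
  proof (cases "b = 0")
    case False
    then have "{..<a} \<inter> {k. 0 < b \<and> Suc k * b \<le> a} = {..<a div b}"
      by (auto simp: less_eq_div_iff_mult_less_eq[symmetric] Suc_le_eq simp del: mult_Suc
          intro: order.strict_trans2[OF _ div_le_dividend])
    then show ?thesis
      by (simp del: mult_Suc)
  qed simp
  ultimately show ?thesis by simp
qed

lemma decidable_odd [recursive_intros]:
  assumes "total_recursive f"
  shows "decidable (\<lambda>x. odd (f x))"
proof -
  have "decidable (\<lambda>x. 2 * (f x div 2) < f x)"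
    by (intro recursive_intros assms)
  moreover have "2 * (n div 2) < n \<longleftrightarrow> odd n" for n :: nat
    by presburger
  ultimately show ?thesis by simp
qed

lemma decidable_mem_set_decode [recursive_intros]:
  assumes "total_recursive f" "total_recursive g"
  shows "decidable (\<lambda>x. f x \<in> set_decode (g x))"
  unfolding set_decode_def mem_Collect_eq by (intro recursive_intros assms)

lemma le_floor_log_iff: "0 < c \<Longrightarrow> j \<le> floor_log c \<longleftrightarrow> 2 ^ j \<le> c"
  by (metis floor_log_exp2_le floor_log_le_iff floor_log_power le_trans one_le_numeral power_increasing)

text \<open>Counting exponents turns the logarithm into a bounded sum, since
  \<open>2 ^ Suc j \<le> c\<close> forces \<open>j < c\<close>.\<close>

lemma floor_log_conv_sum: "floor_log c = (\<Sum>j<c. of_bool (2 ^ Suc j \<le> c))"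
proof (cases "c = 0")
  case False
  have "2 ^ Suc j \<le> c \<Longrightarrow> j < c" for j
    using less_exp[of j] unfolding power_Suc by linarith
  with False have "{..<c} \<inter> {j. 2 ^ Suc j \<le> c} = {..<floor_log c}"
    using le_floor_log_iff[of c] by (auto simp: Suc_le_eq[symmetric] simp del: power_Suc)
  then show ?thesis
    by (simp del: power_Suc)
qed simp

lemma total_recursive_floor_log [recursive_intros]:
  assumes "total_recursive f"
  shows "total_recursive (\<lambda>x. floor_log (f x))"
proof (rule total_recursive_compose[OF _ assms])
  have "total_recursive (\<lambda>c. \<Sum>j<c. of_bool (2 ^ Suc j \<le> c))"
    by (intro recursive_intros)
  then show "total_recursive floor_log"
    by (simp add: floor_log_conv_sum[symmetric] del: power_Suc)
qed

section \<open>Computably enumerable sets\<close>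

lemma comp_enumerable_decidable:
  assumes "decidable (\<lambda>x. x \<in> A)"
  shows "comp_enumerable A"
proof -
  \<comment> \<open>The minimized function ignores the search variable: it is 0 at once on
    \<open>A\<close> and never 0 off \<open>A\<close>, so the search stops exactly on
    \<open>A\<close>.\<close>
  define f where "f = minimization (\<lambda>z. Some (of_bool (pfst z \<notin> A)))"
  have "decidable (\<lambda>z. pfst z \<notin> A)"
    by (intro recursive_intros decidable_compose[OF assms])
  then have "partial_recursive f"
    unfolding f_def
    by (intro partial_recursive.mu) (simp add: total_recursive_def decidable_def)
  moreover have "f x \<noteq> None \<longleftrightarrow> x \<in> A" for x
  proof -
    have "(\<exists>n::nat. x \<in> A \<and> (\<forall>m<n. x \<notin> A)) \<longleftrightarrow> x \<in> A" by blast
    then show ?thesis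
      by (simp add: f_def minimization_def Let_def)
  qed
  then have "A = dom f" by (auto simp: dom_def)
  ultimately show ?thesis
    unfolding comp_enumerable_def by (intro exI conjI)
qed

lemma comp_enumerable_vimage:
  assumes "comp_enumerable A" "total_recursive g"
  shows "comp_enumerable (g -` A)"
proof -
  obtain f where f: "partial_recursive f" "A = dom f"
    using assms(1) by (auto simp: comp_enumerable_def)
  have "partial_recursive (\<lambda>x. f (g x))"
    using partial_recursive.comp[OF f(1) assms(2)[unfolded total_recursive_def]] by simp
  moreover have "g -` A = dom (\<lambda>x. f (g x))"
    by (simp add: f(2) dom_def vimage_def)
  ultimately show ?thesis
    unfolding comp_enumerable_def by (intro exI conjI)
qed

section \<open>A universal enumeration\<close>

text \<open>A judgement \<open>(e, x, y)\<close> says that program \<open>e\<close> maps \<open>x\<close> to \<open>y\<close>. A computation is a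
  finite set of judgements each of which is justified by other members; it needs no order
  because the justification of a judgement recurs to subprograms or, for primitive recursion,
  to a smaller recursion argument.\<close>

definition judgement :: "nat \<Rightarrow> nat \<Rightarrow> nat \<Rightarrow> nat" where
  "judgement e x y = prod_encode (e, prod_encode (x, y))"

text \<open>A constructor number with two subprogram codes; the numbers 0 to 7 follow the order of
  the rules of \<open>partial_recursive\<close>.\<close>

definition program :: "nat \<Rightarrow> nat \<Rightarrow> nat \<Rightarrow> nat" where
  "program k a b = prod_encode (k, prod_encode (a, b))"

definition justified :: "nat set \<Rightarrow> nat \<Rightarrow> nat \<Rightarrow> nat \<Rightarrow> bool" where
  "justified A e x y \<longleftrightarrow> (let k = pfst e; a = pfst (psnd e); b = psnd (psnd e) in
     k = 0 \<and> y = 0 \<or>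
     k = 1 \<and> y = Suc x \<or>
     k = 2 \<and> y = pfst x \<or>
     k = 3 \<and> y = psnd x \<or>
     k = 4 \<and> judgement a x (pfst y) \<in> A \<and> judgement b x (psnd y) \<in> A \<or>
     k = 5 \<and> (\<exists>v. judgement b x v \<in> A \<and> judgement a v y \<in> A) \<or>
     k = 6 \<and> psnd x = 0 \<and> judgement a (pfst x) y \<in> A \<or>
     k = 6 \<and> 0 < psnd x \<and> (\<exists>v. judgement e (prod_encode (pfst x, psnd x - 1)) v \<in> A \<and>
       judgement b (prod_encode (pfst x, prod_encode (psnd x - 1, v))) y \<in> A) \<or>
     k = 7 \<and> judgement a (prod_encode (x, y)) 0 \<in> A \<and>
       (\<forall>m<y. \<exists>v. 0 < v \<and> judgement a (prod_encode (x, m)) v \<in> A))"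

definition computation :: "nat set \<Rightarrow> bool" where
  "computation A \<longleftrightarrow> (\<forall>e x y. judgement e x y \<in> A \<longrightarrow> justified A e x y)"

definition computes :: "nat \<Rightarrow> nat \<Rightarrow> nat \<Rightarrow> bool" where
  "computes e x y \<longleftrightarrow> (\<exists>A. finite A \<and> computation A \<and> judgement e x y \<in> A)"

text \<open>Membership in \<open>A\<close> occurs only positively: minimization asks for a positive
  value at each smaller argument, not for the absence of the value 0.\<close>

lemma justified_mono: "justified A e x y \<Longrightarrow> A \<subseteq> B \<Longrightarrow> justified B e x y"
  unfolding justified_def Let_def by (elim disjE conjE exE; simp; blast)

lemma judgement_eq_iff [simp]: "judgement e x y = judgement e' x' y' \<longleftrightarrow> e = e' \<and> x = x' \<and> y = y'"
  by (simp add: judgement_def)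

text \<open>The union of computations of the premises, with the new judgement added, is again a
  computation by monotonicity.\<close>

lemma computes_of_subset:
  assumes "finite B" "\<And>j. j \<in> B \<Longrightarrow> \<exists>A. finite A \<and> computation A \<and> j \<in> A"
    and "justified B e x y"
  shows "computes e x y"
proof -
  obtain A where A: "\<And>j. j \<in> B \<Longrightarrow> finite (A j) \<and> computation (A j) \<and> j \<in> A j"
    using assms(2) by metis
  define C where "C = insert (judgement e x y) (\<Union>j\<in>B. A j)"
  have "B \<subseteq> C" using A by (auto simp: C_def)
  have "computation C"
    unfolding computation_def
  proof (intro allI impI)
    fix e' x' y' assume "judgement e' x' y' \<in> C"
    then consider "e' = e" "x' = x" "y' = y" | j where "j \<in> B" "judgement e' x' y' \<in> A j"
      by (auto simp: C_def)
    then show "justified C e' x' y'"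
    proof cases
      case 1
      with assms(3) \<open>B \<subseteq> C\<close> show ?thesis by (auto intro: justified_mono)
    next
      case 2
      with A have "justified (A j) e' x' y'" by (auto simp: computation_def)
      moreover have "A j \<subseteq> C" using 2 by (auto simp: C_def)
      ultimately show ?thesis by (rule justified_mono)
    qed
  qed
  moreover have "finite C" using assms(1) A by (auto simp: C_def)
  ultimately show ?thesis
    by (auto simp: computes_def C_def)
qed

lemma computes_if_justified:
  assumes "finite B" "justified ((\<lambda>(e, x, y). judgement e x y) ` B) e x y"
    and "\<And>e x y. (e, x, y) \<in> B \<Longrightarrow> computes e x y"
  shows "computes e x y"
  by (rule computes_of_subset[OF _ _ assms(2)]) (use assms in \<open>auto simp: computes_def\<close>)

text \<open>Inversion: one computation serves all its members. With the preceding introduction rule,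
  each program constructor reduces to a single unfolding of \<open>justified\<close>.\<close>

lemma computes_justified:
  assumes "computes e x y"
  shows "\<exists>A. finite A \<and> justified A e x y \<and> (\<forall>e x y. judgement e x y \<in> A \<longrightarrow> computes e x y)"
  using assms unfolding computes_def computation_def by blast

text \<open>The equivalence, rather than one implication, carries uniqueness of outputs through the
  induction; primitive recursion needs an inner induction on the recursion argument.\<close>

lemma program_complete:
  assumes "partial_recursive f"
  shows "\<exists>e. \<forall>x y. computes e x y \<longleftrightarrow> f x = Some y"
  using assms
proof induction
  case zero
  have "computes (program 0 0 0) x y \<longleftrightarrow> y = 0" for x y
    by (auto dest!: computes_justified intro!: computes_if_justified[of "{}"]
        simp: justified_def program_def)
  then show ?case by (intro exI[of _ "program 0 0 0"]) auto
next
  case succ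
  have "computes (program 1 0 0) x y \<longleftrightarrow> y = Suc x" for x y
    by (auto dest!: computes_justified intro!: computes_if_justified[of "{}"]
        simp: justified_def program_def)
  then show ?case by (intro exI[of _ "program 1 0 0"]) auto
next
  case proj1
  have "computes (program 2 0 0) x y \<longleftrightarrow> y = pfst x" for x y
    by (auto dest!: computes_justified intro!: computes_if_justified[of "{}"]
        simp: justified_def program_def)
  then show ?case by (intro exI[of _ "program 2 0 0"]) auto
next
  case proj2
  have "computes (program 3 0 0) x y \<longleftrightarrow> y = psnd x" for x y
    by (auto dest!: computes_justified intro!: computes_if_justified[of "{}"]
        simp: justified_def program_def)
  then show ?case by (intro exI[of _ "program 3 0 0"]) auto
next
  case (pair f g)
  then obtain a b where a: "\<And>x y. computes a x y \<longleftrightarrow> f x = Some y"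
    and b: "\<And>x y. computes b x y \<longleftrightarrow> g x = Some y" by metis
  have "computes (program 4 a b) x y \<longleftrightarrow> computes a x (pfst y) \<and> computes b x (psnd y)" (is "_ \<longleftrightarrow> ?R")
    for x y
  proof
    assume "computes (program 4 a b) x y"
    from computes_justified[OF this] show ?R
      by (clarsimp simp: justified_def program_def; blast)
  next
    assume ?R
    then show "computes (program 4 a b) x y"
      by - (rule computes_if_justified[of "{(a, x, pfst y), (b, x, psnd y)}"],
          auto simp: justified_def program_def)
  qed
  then show ?case
    by (intro exI[of _ "program 4 a b"]) (auto simp: a b bind_eq_Some_conv)
next
  case (comp f g)
  then obtain a b where a: "\<And>x y. computes a x y \<longleftrightarrow> f x = Some y"
    and b: "\<And>x y. computes b x y \<longleftrightarrow> g x = Some y" by metis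
  have "computes (program 5 a b) x y \<longleftrightarrow> (\<exists>v. computes b x v \<and> computes a v y)" (is "_ \<longleftrightarrow> ?R")
    for x y
  proof
    assume "computes (program 5 a b) x y"
    from computes_justified[OF this] show ?R
      by (clarsimp simp: justified_def program_def; blast)
  next
    assume ?R
    then obtain v where "computes b x v" "computes a v y" by blast
    then show "computes (program 5 a b) x y"
      by - (rule computes_if_justified[of "{(b, x, v), (a, v, y)}"],
          auto simp: justified_def program_def)
  qed
  then show ?case
    by (intro exI[of _ "program 5 a b"]) (auto simp: a b bind_eq_Some_conv)
next
  case (prec f g)
  then obtain a b where a: "\<And>x y. computes a x y \<longleftrightarrow> f x = Some y"
    and b: "\<And>x y. computes b x y \<longleftrightarrow> g x = Some y" by metis
  define e where "e = program 6 a b"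
  have 0: "computes e (prod_encode (x, 0)) y \<longleftrightarrow> computes a x y" (is "_ \<longleftrightarrow> ?R") for x y
  proof
    assume "computes e (prod_encode (x, 0)) y"
    from computes_justified[OF this] show ?R
      by (clarsimp simp: justified_def program_def e_def; blast)
  next
    assume ?R
    then show "computes e (prod_encode (x, 0)) y"
      by - (rule computes_if_justified[of "{(a, x, y)}"],
          auto simp: justified_def program_def e_def)
  qed
  have Suc: "computes e (prod_encode (x, Suc n)) y \<longleftrightarrow>
      (\<exists>v. computes e (prod_encode (x, n)) v \<and>
           computes b (prod_encode (x, prod_encode (n, v))) y)" (is "_ \<longleftrightarrow> ?R") for x n y
  proof
    assume "computes e (prod_encode (x, Suc n)) y"
    from computes_justified[OF this] show ?R
      by (clarsimp simp: justified_def program_def e_def; blast)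
  next
    assume ?R
    then obtain v where "computes e (prod_encode (x, n)) v"
      "computes b (prod_encode (x, prod_encode (n, v))) y" by blast
    then show "computes e (prod_encode (x, Suc n)) y"
      by - (rule computes_if_justified[of "{(e, prod_encode (x, n), v),
          (b, prod_encode (x, prod_encode (n, v)), y)}"],
          auto simp: justified_def program_def e_def)
  qed
  have "computes e (prod_encode (x, n)) y \<longleftrightarrow> prim_recursion f g (prod_encode (x, n)) = Some y"
    for x n y
    by (induction n arbitrary: y)
       (auto simp: 0 Suc a b prim_recursion_def bind_eq_Some_conv)
  then show ?case
    by (metis prod_decode_inverse surj_pair)
next
  case (mu f)
  then obtain a where a: "\<And>x y. computes a x y \<longleftrightarrow> f x = Some y" by metis
  have *: "computes (program 7 a 0) x y \<longleftrightarrow> computes a (prod_encode (x, y)) 0 \<and>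
      (\<forall>m<y. \<exists>v>0. computes a (prod_encode (x, m)) v)" (is "_ \<longleftrightarrow> ?R") for x y
  proof
    assume "computes (program 7 a 0) x y"
    from computes_justified[OF this] show ?R
      by (clarsimp simp: justified_def program_def; blast)
  next
    assume ?R
    then obtain v where v: "\<And>m. m < y \<Longrightarrow> 0 < v m \<and> computes a (prod_encode (x, m)) (v m)"
      and "computes a (prod_encode (x, y)) 0" by metis
    then show "computes (program 7 a 0) x y"
      by - (rule computes_if_justified[of "insert (a, prod_encode (x, y), 0)
          ((\<lambda>m. (a, prod_encode (x, m), v m)) ` {..<y})"],
          auto simp: justified_def program_def image_iff)
  qed
  \<comment> \<open>Positive values below the zero make the stopping point unique, so
    \<open>THE\<close> returns it.\<close>
  have "f (prod_encode (x, y)) = Some 0 \<and> (\<forall>m<y. \<exists>v>0. f (prod_encode (x, m)) = Some v)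
      \<longleftrightarrow> minimization f x = Some y" (is "?h y \<longleftrightarrow> _") for x y
  proof -
    have "y = z" if "?h y" "?h z" for y z
      using that by (cases y z rule: linorder_cases) fastforce+
    then have "?h y \<Longrightarrow> (THE y. ?h y) = y" for y
      by (intro the_equality)
    then show ?thesis
      unfolding minimization_def Let_def by (auto split: if_splits)
  qed
  then show ?case
    by (intro exI[of _ "program 7 a 0"]) (simp add: * a)
qed

text \<open>The number \<open>p\<close> is a certificate, a finite set of judgements written in
  binary, not a step count. The predicate is not monotone in \<open>p\<close>; monotonicity returns
  on quantifying over all \<open>p\<close> below a bound.\<close>

definition halts_within :: "nat \<Rightarrow> nat \<Rightarrow> nat \<Rightarrow> bool" where
  "halts_within e x p \<longleftrightarrow> computation (set_decode p) \<and> (\<exists>y. judgement e x y \<in> set_decode p)"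

lemma comp_enumerable_index:
  assumes "comp_enumerable A"
  obtains e where "\<And>x. x \<in> A \<longleftrightarrow> (\<exists>p. halts_within e x p)"
proof -
  obtain f where f: "partial_recursive f" "A = dom f"
    using assms by (auto simp: comp_enumerable_def)
  obtain e where e: "\<And>x y. computes e x y \<longleftrightarrow> f x = Some y"
    using program_complete[OF f(1)] by blast
  have "x \<in> A \<longleftrightarrow> (\<exists>y. computes e x y)" for x
    using f e by auto
  also have "\<dots> x \<longleftrightarrow> (\<exists>p. halts_within e x p)" for x
    unfolding computes_def halts_within_def
    by (metis finite_set_decode set_encode_inverse)
  finally show thesis using that by blast
qed

lemma mem_set_decode_less: "j \<in> set_decode p \<Longrightarrow> j < p"
  by (metis div_less even_zero less_exp linorder_not_less mem_Collect_eq order_less_le_trans set_decode_def)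

lemma judgement_ge: "e \<le> judgement e x y" "x \<le> judgement e x y" "y \<le> judgement e x y"
  unfolding judgement_def
  by (meson le_prod_encode_1 le_prod_encode_2 le_trans)+

lemma judgement_mem_less:
  assumes "judgement e x y \<in> set_decode p"
  shows "e < p" "x < p" "y < p"
  using mem_set_decode_less[OF assms] judgement_ge(1)[of e x y] judgement_ge(2)[of x e y]
    judgement_ge(3)[of y e x] by linarith+

text \<open>The components of a judgement in \<open>set_decode p\<close> are below \<open>p\<close>;
  bounding the witnesses this way brings justification within reach of the closure rules.\<close>

lemma justified_set_decode:
  "justified (set_decode p) e x y \<longleftrightarrow>
     pfst e = 0 \<and> y = 0 \<or>
     pfst e = 1 \<and> y = Suc x \<or>
     pfst e = 2 \<and> y = pfst x \<or>
     pfst e = 3 \<and> y = psnd x \<or>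
     pfst e = 4 \<and> judgement (pfst (psnd e)) x (pfst y) \<in> set_decode p \<and>
       judgement (psnd (psnd e)) x (psnd y) \<in> set_decode p \<or>
     pfst e = 5 \<and> (\<exists>v<p. judgement (psnd (psnd e)) x v \<in> set_decode p \<and>
       judgement (pfst (psnd e)) v y \<in> set_decode p) \<or>
     pfst e = 6 \<and> psnd x = 0 \<and> judgement (pfst (psnd e)) (pfst x) y \<in> set_decode p \<or>
     pfst e = 6 \<and> 0 < psnd x \<and>
       (\<exists>v<p. judgement e (prod_encode (pfst x, psnd x - 1)) v \<in> set_decode p \<and>
         judgement (psnd (psnd e)) (prod_encode (pfst x, prod_encode (psnd x - 1, v))) y
           \<in> set_decode p) \<or>
     pfst e = 7 \<and> judgement (pfst (psnd e)) (prod_encode (x, y)) 0 \<in> set_decode p \<and>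
       (\<forall>m<y. \<exists>v<p. 0 < v \<and> judgement (pfst (psnd e)) (prod_encode (x, m)) v \<in> set_decode p)"
proof -
  have bound: "(\<exists>v. P v \<and> Q v) \<longleftrightarrow> (\<exists>v<p. P v \<and> Q v)"
    if "\<And>v. P v \<and> Q v \<Longrightarrow> v < p" for P Q :: "nat \<Rightarrow> bool"
    using that by blast
  show ?thesis
    unfolding justified_def Let_def
    by (subst (1 2 3) bound) (auto dest: judgement_mem_less)
qed

lemma halts_within_iff:
  "halts_within e x p \<longleftrightarrow>
     (\<forall>e<p. \<forall>x<p. \<forall>y<p. judgement e x y \<in> set_decode p \<longrightarrow> justified (set_decode p) e x y) \<and>
     (\<exists>y<p. judgement e x y \<in> set_decode p)"
  unfolding halts_within_def computation_def
  by (intro conj_cong; meson judgement_mem_less)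

lemma decidable_halts_within [recursive_intros]:
  assumes "total_recursive e" "total_recursive x" "total_recursive p"
  shows "decidable (\<lambda>z. halts_within (e z) (x z) (p z))"
proof -
  have "decidable (\<lambda>z. halts_within (pfst z) (pfst (psnd z)) (psnd (psnd z)))"
    unfolding halts_within_iff justified_set_decode judgement_def
    by (intro recursive_intros)
  from decidable_compose[OF this, of "\<lambda>z. prod_encode (e z, prod_encode (x z, p z))"] assms
  show ?thesis by (simp add: recursive_intros)
qed

section \<open>Nodes of the binary tree\<close>

text \<open>The string \<open>\<sigma>\<close> is coded by the number whose binary expansion is \<open>1\<sigma>\<close>, so that removing
  the last bit is division by two and, on each level, the order of the codes is the
  lexicographic order.\<close>

primrec prefix_node :: "cantor \<Rightarrow> nat \<Rightarrow> nat" where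
  "prefix_node X 0 = 1"
| "prefix_node X (Suc n) = 2 * prefix_node X n + of_bool (X n)"

text \<open>The prefix of length \<open>i\<close> of the coded string; beyond its length, truncated
  subtraction returns \<open>c\<close> itself.\<close>

definition ancestor :: "nat \<Rightarrow> nat \<Rightarrow> nat" where
  "ancestor c i = c div 2 ^ (floor_log c - i)"

lemma prefix_node_ge: "2 ^ n \<le> prefix_node X n"
  by (induction n) auto

lemma prefix_node_less: "prefix_node X n < 2 ^ Suc n"
  by (induction n) auto

lemma floor_log_prefix_node [simp]: "floor_log (prefix_node X n) = n"
  using prefix_node_ge[of n X] prefix_node_less[of X n]
  by (intro floor_log_eqI) (auto intro: order.strict_trans2[of _ "2 ^ n"])

lemma prefix_node_div: "prefix_node X (m + k) div 2 ^ k = prefix_node X m"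
proof (induction k)
  case (Suc k)
  have "prefix_node X (m + Suc k) div 2 ^ Suc k = prefix_node X (m + Suc k) div 2 div 2 ^ k"
    by (simp add: div_mult2_eq)
  also have "prefix_node X (m + Suc k) div 2 = prefix_node X (m + k)"
    by simp
  finally show ?case using Suc by simp
qed simp

lemma ancestor_prefix_node [simp]: "i \<le> n \<Longrightarrow> ancestor (prefix_node X n) i = prefix_node X i"
  using prefix_node_div[of X i "n - i"] by (simp add: ancestor_def)

lemma odd_prefix_node_Suc [simp]: "odd (prefix_node X (Suc n)) \<longleftrightarrow> X n"
  by simp

lemma prefix_node_eq_iff: "prefix_node X n = prefix_node Y n \<longleftrightarrow> (\<forall>i<n. X i = Y i)"
proof (induction n)
  case (Suc n)
  have "2 * a + of_bool p = 2 * b + of_bool q \<longleftrightarrow> a = b \<and> p = q" for a b :: nat and p q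
    by (cases p; cases q; simp; presburger)
  with Suc show ?case by (auto simp: less_Suc_eq)
qed simp

lemma ex_prefix_node:
  assumes "0 < c"
  obtains X where "c = prefix_node X (floor_log c)"
proof -
  \<comment> \<open>Bit \<open>i\<close> is the last bit of the prefix of length
    \<open>Suc i\<close>.\<close>
  define X where "X = (\<lambda>i. odd (ancestor c (Suc i)))"
  have "prefix_node X i = ancestor c i" if "i \<le> floor_log c" for i
    using that
  proof (induction i)
    case 0
    have "c div 2 ^ floor_log c = 1"
      using floor_log_exp2_le[OF assms] floor_log_exp2_gt[of c]
      by (intro div_nat_eqI) auto
    then show ?case by (simp add: ancestor_def)
  next
    case (Suc i)
    then have "floor_log c - i = Suc (floor_log c - Suc i)" by simp
    then have "ancestor c i = ancestor c (Suc i) div 2"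
      by (simp add: ancestor_def div_mult2_eq[symmetric] mult.commute)
    with Suc show ?case
      by (simp add: X_def)
  qed
  from this[of "floor_log c"] show thesis
    by (intro that[of X]) (simp add: ancestor_def)
qed

definition node :: "bool list \<Rightarrow> nat" where
  "node \<sigma> = prefix_node (\<lambda>i. \<sigma> ! i) (length \<sigma>)"

lemma mem_cylinder_iff: "X \<in> cylinder \<sigma> \<longleftrightarrow> prefix_node X (length \<sigma>) = node \<sigma>"
  by (simp add: cylinder_def node_def prefix_node_eq_iff)

lemma open_prefix_node: "open {X. prefix_node X n \<in> A}"
proof -
  have "{X. prefix_node X n \<in> A} = (\<Union>Y\<in>{Y. prefix_node Y n \<in> A}. cylinder (map Y [0..<n]))"
    by (auto simp: mem_cylinder_iff node_def prefix_node_eq_iff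
        intro!: exI[of _ "prefix_node _ _"])
       (metis (no_types, lifting) prefix_node_eq_iff)+
  then show ?thesis
    by (metis open_UN open_cylinder)
qed

lemma sets_prefix_node [measurable]: "{X. prefix_node X n \<in> A} \<in> sets borel"
  by (simp add: open_prefix_node)

lemma sets_prefix_node_eq [measurable]: "{X. prefix_node X n = c} \<in> sets borel"
  using sets_prefix_node[of n "{c}"] by simp

section \<open>Measures given by a set of splitting nodes\<close>

text \<open>The mass of a node in \<open>R\<close> is shared equally by its two children; the mass of any other
  node goes to its right child.\<close>

definition alive :: "nat set \<Rightarrow> nat \<Rightarrow> bool" where
  "alive R c \<longleftrightarrow> (\<forall>i<floor_log c. ancestor c i \<in> R \<or> odd (ancestor c (Suc i)))"

definition splits :: "nat set \<Rightarrow> nat \<Rightarrow> nat" where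
  "splits R c = (\<Sum>i<floor_log c. of_bool (ancestor c i \<in> R))"

definition weight :: "nat set \<Rightarrow> nat \<Rightarrow> real" where
  "weight R c = of_bool (alive R c) / 2 ^ splits R c"


text \<open>The implication selects the next bit: the coin decides at a node of \<open>R\<close>,
  and elsewhere the bit is 1.\<close>

primrec walk :: "nat set \<Rightarrow> cantor \<Rightarrow> nat \<Rightarrow> nat" where
  "walk R \<xi> 0 = 1"
| "walk R \<xi> (Suc n) = 2 * walk R \<xi> n + of_bool (walk R \<xi> n \<in> R \<longrightarrow> \<xi> n)"

definition coin_flips :: "cantor measure" where
  "coin_flips = (\<Pi>\<^sub>M i\<in>UNIV. measure_pmf (bernoulli_pmf (1/2)))"

text \<open>As the image of the fair-coin measure, it is a countably additive probability measure
  from the outset; only the cylinder values remain to be computed.\<close>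

definition splitting_measure :: "nat set \<Rightarrow> cantor measure" where
  "splitting_measure R = distr coin_flips borel (\<lambda>\<xi> n. walk R \<xi> n \<in> R \<longrightarrow> \<xi> n)"

interpretation coin_flips: product_prob_space "\<lambda>_. measure_pmf (bernoulli_pmf (1/2))" "UNIV :: nat set"
  by unfold_locales

lemma alive_prefix_node: "alive R (prefix_node X n) \<longleftrightarrow> (\<forall>i<n. prefix_node X i \<in> R \<or> X i)"
  by (auto simp: alive_def simp del: prefix_node.simps)

lemma splits_prefix_node: "splits R (prefix_node X n) = card {i. i < n \<and> prefix_node X i \<in> R}"
  by (simp add: splits_def Int_def lessThan_def)

lemma prefix_node_walk: "prefix_node (\<lambda>n. walk R \<xi> n \<in> R \<longrightarrow> \<xi> n) n = walk R \<xi> n"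
  by (induction n) auto

lemma prob_space_coin_flips: "prob_space coin_flips"
  unfolding coin_flips_def by (rule coin_flips.P.prob_space_axioms)

lemma measurable_coin [measurable]: "(\<lambda>\<xi>. \<xi> n) \<in> measurable coin_flips (count_space UNIV)"
  unfolding coin_flips_def
  by (rule measurable_compose[OF measurable_component_singleton]) auto

lemma measurable_walk [measurable]: "(\<lambda>\<xi>. walk R \<xi> n) \<in> measurable coin_flips (count_space UNIV)"
proof (induction n)
  case (Suc n)
  note [measurable] = Suc
  show ?case by simp
qed simp

lemma measurable_follow: "(\<lambda>\<xi> n. walk R \<xi> n \<in> R \<longrightarrow> \<xi> n) \<in> measurable coin_flips borel"
proof -
  have [measurable]: "Measurable.pred coin_flips (\<lambda>\<xi>. walk R \<xi> n \<in> R)" for n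
    by (rule measurable_compose[OF measurable_walk]) simp
  have "(\<lambda>\<xi> n. walk R \<xi> n \<in> R \<longrightarrow> \<xi> n) \<in> measurable coin_flips (\<Pi>\<^sub>M i\<in>UNIV. count_space UNIV)"
  proof (rule measurable_PiM_single')
    show "(\<lambda>\<xi>. walk R \<xi> n \<in> R \<longrightarrow> \<xi> n) \<in> measurable coin_flips (count_space UNIV)" for n
      by measurable
  qed auto
  then show ?thesis
    by (simp add: measurable_cong_sets[OF refl sets_borel_cantor])
qed

lemma prob_space_splitting_measure: "prob_space (splitting_measure R)"
  unfolding splitting_measure_def
  by (rule prob_space.prob_space_distr[OF prob_space_coin_flips measurable_follow])

lemma sets_splitting_measure [measurable_cong, simp]: "sets (splitting_measure R) = sets borel"
  by (simp add: splitting_measure_def)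

lemma space_splitting_measure [simp]: "space (splitting_measure R) = UNIV"
  by (simp add: splitting_measure_def)

text \<open>Reaching an alive node constrains exactly the coins at its splitting proper ancestors,
  each with probability 1/2; a node that is not alive is never reached.\<close>

lemma measure_prefix_node_eq:
  "measure (splitting_measure R) {Y. prefix_node Y n = prefix_node X n} = weight R (prefix_node X n)"
proof -
  define J where "J = {i. i < n \<and> prefix_node X i \<in> R}"
  have iff: "walk R \<xi> n = prefix_node X n \<longleftrightarrow> alive R (prefix_node X n) \<and> (\<forall>i\<in>J. \<xi> i = X i)" for \<xi>
  proof -
    have "walk R \<xi> n = prefix_node X n \<longleftrightarrow> (\<forall>i<n. (prefix_node X i \<in> R \<longrightarrow> \<xi> i) = X i)" for n
    proof (induction n)
      case (Suc n)
      have "2 * a + of_bool p = 2 * b + of_bool q \<longleftrightarrow> a = b \<and> p = q" for a b :: nat and p q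
        by (cases p; cases q; simp; presburger)
      with Suc show ?case by (auto simp: less_Suc_eq)
    qed simp
    then show ?thesis
      by (auto simp: alive_prefix_node J_def)
  qed
  have "measure (splitting_measure R) {Y. prefix_node Y n = prefix_node X n}
      = measure coin_flips {\<xi>. walk R \<xi> n = prefix_node X n}"
    unfolding splitting_measure_def
    by (subst measure_distr[OF measurable_follow])
       (auto simp: prefix_node_walk vimage_def coin_flips_def space_PiM)
  also have "\<dots> = weight R (prefix_node X n)"
  proof (cases "alive R (prefix_node X n)")
    case True
    have "{\<xi>. walk R \<xi> n = prefix_node X n}
        = prod_emb UNIV (\<lambda>_. measure_pmf (bernoulli_pmf (1/2))) J (\<Pi>\<^sub>E i\<in>J. {X i})"
    proof (rule set_eqI)
      fix \<xi> :: cantor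
      have "restrict \<xi> J \<in> (\<Pi>\<^sub>E i\<in>J. {X i}) \<longleftrightarrow> (\<forall>i\<in>J. \<xi> i = X i)"
        unfolding PiE_iff by simp
      with True show "\<xi> \<in> {\<xi>. walk R \<xi> n = prefix_node X n} \<longleftrightarrow>
          \<xi> \<in> prod_emb UNIV (\<lambda>_. measure_pmf (bernoulli_pmf (1/2))) J (\<Pi>\<^sub>E i\<in>J. {X i})"
        unfolding prod_emb_iff mem_Collect_eq iff by simp
    qed
    also have "measure coin_flips \<dots> = (\<Prod>i\<in>J. measure (bernoulli_pmf (1/2)) {X i})"
      unfolding coin_flips_def by (subst coin_flips.measure_PiM_emb) (auto simp: J_def)
    also have "\<dots> = (\<Prod>i\<in>J. 1 / 2)"
    proof (intro prod.cong refl)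
      show "measure (bernoulli_pmf (1/2)) {X i} = 1 / 2" for i
        by (cases "X i") (simp_all add: measure_pmf_single)
    qed
    finally show ?thesis
      using True by (simp add: weight_def splits_prefix_node J_def power_one_over)
  qed (simp add: iff weight_def)
  finally show ?thesis .
qed

lemma measure_level:
  "measure (splitting_measure R) {X. prefix_node X n \<in> A}
    = (\<Sum>c=2^n..<2^Suc n. of_bool (c \<in> A) * weight R c)"
proof -
  interpret prob_space "splitting_measure R" by (rule prob_space_splitting_measure)
  let ?L = "{2^n..<2^Suc n} :: nat set"
  have "{X. prefix_node X n \<in> A} = (\<Union>c\<in>?L \<inter> A. {X. prefix_node X n = c})"
    using prefix_node_ge prefix_node_less by auto
  also have "measure (splitting_measure R) \<dots>
      = (\<Sum>c\<in>?L \<inter> A. measure (splitting_measure R) {X. prefix_node X n = c})"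
    by (intro finite_measure_finite_Union) (auto simp: disjoint_family_on_def)
  also have "\<dots> = (\<Sum>c\<in>?L \<inter> A. weight R c)"
  proof (intro sum.cong refl)
    fix c assume "c \<in> ?L \<inter> A"
    then have "0 < c" "floor_log c = n"
      by (auto intro: order.strict_trans2[of _ "2 ^ n"] floor_log_eqI)
    then obtain X where "c = prefix_node X n" by (metis ex_prefix_node)
    then show "measure (splitting_measure R) {X. prefix_node X n = c} = weight R c"
      using measure_prefix_node_eq by simp
  qed
  also have "\<dots> = (\<Sum>c\<in>?L. if c \<in> A then weight R c else 0)"
    by (rule sum.inter_restrict) simp
  also have "\<dots> = (\<Sum>c\<in>?L. of_bool (c \<in> A) * weight R c)"
    by (intro sum.cong refl) simp
  finally show ?thesis .
qed

section \<open>The splitting nodes\<close>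

text \<open>A test is a program run on pairs (component, node code). The code \<open>d\<close> also
  bounds the certificate; codes grow along a path, so coverage persists and every halting run is
  eventually seen.\<close>

definition covers :: "nat \<Rightarrow> nat \<Rightarrow> bool" where
  "covers e d \<longleftrightarrow>
     (\<exists>i\<le>floor_log d. \<exists>p<d. halts_within e (prod_encode (e + 2, ancestor d i)) p)"

text \<open>The measure of the set covered by \<open>e\<close> at level \<open>n\<close>, in units of \<open>2^-n\<close> to keep it a natural
  number. It depends only on the members of \<open>R\<close> below level \<open>n\<close>, so the set of splitting nodes
  can be defined by recursion on the code.\<close>

definition mass :: "nat set \<Rightarrow> nat \<Rightarrow> nat \<Rightarrow> nat" where
  "mass R e n = (\<Sum>k<2^n. of_bool (covers e (2^n + k) \<and> alive R (2^n + k)) *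
     2 ^ (n - splits R (2^n + k)))"

text \<open>The inequality is the bound \<open>(1/2)^(e+2)\<close> on the covered measure with
  denominators cleared. The bound \<open>e < d\<close> keeps the search finite, yet along a path
  every program is eventually consulted.\<close>

definition forbidden :: "nat set \<Rightarrow> nat \<Rightarrow> bool" where
  "forbidden R d \<longleftrightarrow>
     (\<exists>e<d. covers e d \<and> 2 ^ (e + 2) * mass R e (floor_log d) \<le> 2 ^ floor_log d)"

text \<open>All ancestors are examined, so a node blocked by a program within budget stays blocked
  after that program overspends. Thus admissibility passes to prefixes.\<close>

definition admissible :: "nat set \<Rightarrow> nat \<Rightarrow> bool" where
  "admissible R c \<longleftrightarrow>
     0 < c \<and> alive R c \<and> (\<forall>i\<le>floor_log c. \<not> forbidden R (ancestor c i))"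

text \<open>Leftmost is expressed by the absence of an earlier member of \<open>R\<close> on the
  level, which refers to \<open>R\<close> only below \<open>c\<close>.\<close>

definition chosen :: "nat set \<Rightarrow> nat \<Rightarrow> bool" where
  "chosen R c \<longleftrightarrow> admissible R c \<and> (\<forall>d<c. d \<in> R \<longrightarrow> floor_log d \<noteq> floor_log c)"

text \<open>Course-of-values recursion in primitive recursive form: the accumulator holds in binary
  the set of codes chosen so far.\<close>

definition history :: "nat \<Rightarrow> nat" where
  "history = rec_nat 0 (\<lambda>c r. if chosen (set_decode r) c then r + 2 ^ c else r)"

definition splitting :: "nat set" where
  "splitting = {c. chosen (set_decode (history c)) c}"

section \<open>Decidability of the set of splitting nodes\<close>

lemma total_recursive_ancestor [recursive_intros]:
  assumes "total_recursive f" "total_recursive g"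
  shows "total_recursive (\<lambda>x. ancestor (f x) (g x))"
  unfolding ancestor_def by (intro recursive_intros assms)

lemma decidable_covers [recursive_intros]:
  assumes "total_recursive f" "total_recursive g"
  shows "decidable (\<lambda>x. covers (f x) (g x))"
  by (rule decidable_compose2[OF _ assms]) (unfold covers_def, intro recursive_intros)

lemma decidable_alive:
  assumes "decidable (\<lambda>z. psnd z \<in> R (pfst z))"
  shows "decidable (\<lambda>z. alive (R (pfst z)) (psnd z))"
  unfolding alive_def
  by (intro recursive_intros decidable_compose2[where P = "\<lambda>x y. y \<in> R x", OF assms])

lemma total_recursive_splits:
  assumes "decidable (\<lambda>z. psnd z \<in> R (pfst z))"
  shows "total_recursive (\<lambda>z. splits (R (pfst z)) (psnd z))"
  unfolding splits_def
  by (intro recursive_intros decidable_compose2[where P = "\<lambda>x y. y \<in> R x", OF assms])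

text \<open>The set argument is supplied as a number through \<open>set_decode\<close>, so
  dependence on a set becomes dependence on an ordinary argument.\<close>

lemma decidable_chosen: "decidable (\<lambda>z. chosen (set_decode (pfst z)) (psnd z))"
proof -
  have mem: "decidable (\<lambda>z. psnd z \<in> set_decode (pfst z))"
    by (intro recursive_intros)
  note [recursive_intros] =
    decidable_compose2[where P = "\<lambda>r. alive (set_decode r)", OF decidable_alive[OF mem]]
    total_recursive_compose2[where F = "\<lambda>r. splits (set_decode r)", OF total_recursive_splits[OF mem]]
  have "total_recursive (\<lambda>z. mass (set_decode (pfst z)) (pfst (psnd z)) (psnd (psnd z)))"
    unfolding mass_def by (intro recursive_intros)
  from total_recursive_compose[OF this total_recursive_prod_encode[OF _ total_recursive_prod_encode]]
  have [recursive_intros]: "total_recursive (\<lambda>x. mass (set_decode (f x)) (g x) (h x))"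
    if "total_recursive f" "total_recursive g" "total_recursive h" for f g h
    using that by simp
  have "decidable (\<lambda>z. forbidden (set_decode (pfst z)) (psnd z))"
    unfolding forbidden_def by (intro recursive_intros)
  note [recursive_intros] = decidable_compose2[where P = "\<lambda>r. forbidden (set_decode r)", OF this]
  show ?thesis
    unfolding chosen_def admissible_def by (intro recursive_intros)
qed

lemma decidable_splitting [recursive_intros]:
  assumes "total_recursive f"
  shows "decidable (\<lambda>x. f x \<in> splitting)"
proof (rule decidable_compose[OF _ assms])
  note [recursive_intros] = decidable_compose2[where P = "\<lambda>r. chosen (set_decode r)", OF decidable_chosen]
  show "decidable (\<lambda>c. c \<in> splitting)"
    unfolding splitting_def history_def mem_Collect_eq by (intro recursive_intros)
qed

lemma decidable_alive_splitting [recursive_intros]: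
  assumes "total_recursive f"
  shows "decidable (\<lambda>x. alive splitting (f x))"
  by (rule decidable_compose[OF _ assms]) (unfold alive_def, intro recursive_intros)

lemma total_recursive_splits_splitting [recursive_intros]:
  assumes "total_recursive f"
  shows "total_recursive (\<lambda>x. splits splitting (f x))"
  by (rule total_recursive_compose[OF _ assms]) (unfold splits_def, intro recursive_intros)

section \<open>The recursion equation of the construction\<close>

lemma prefix_node_less_power: "i < n \<Longrightarrow> prefix_node X i < 2 ^ n"
  using prefix_node_less[of X i] power_increasing[of "Suc i" n "2::nat"] by linarith

lemma alive_splits_cong:
  assumes "0 < c" "\<And>d. d < 2 ^ floor_log c \<Longrightarrow> d \<in> R \<longleftrightarrow> d \<in> R'"
  shows "alive R c \<longleftrightarrow> alive R' c" "splits R c = splits R' c"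
proof -
  obtain X where X: "c = prefix_node X (floor_log c)" by (rule ex_prefix_node[OF assms(1)])
  define n where "n = floor_log c"
  have "prefix_node X i \<in> R \<longleftrightarrow> prefix_node X i \<in> R'" if "i < n" for i
    using assms(2) prefix_node_less_power[OF that] by (simp add: n_def)
  with X[folded n_def] show "alive R c \<longleftrightarrow> alive R' c" "splits R c = splits R' c"
    by (auto simp: alive_prefix_node splits_prefix_node intro!: arg_cong[where f = card])
qed

lemma floor_log_level: "k < 2 ^ n \<Longrightarrow> floor_log (2 ^ n + k) = n"
  by (rule floor_log_eqI) (auto simp: add_pos_nonneg)

lemma mass_cong:
  assumes "\<And>d. d < 2 ^ n \<Longrightarrow> d \<in> R \<longleftrightarrow> d \<in> R'"
  shows "mass R e n = mass R' e n"
  unfolding mass_def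
proof (intro sum.cong refl)
  fix k :: nat assume "k \<in> {..<2 ^ n}"
  then have "floor_log (2 ^ n + k) = n" by (simp add: floor_log_level)
  with alive_splits_cong[of "2 ^ n + k" R R'] assms
  show "of_bool (covers e (2 ^ n + k) \<and> alive R (2 ^ n + k)) * 2 ^ (n - splits R (2 ^ n + k))
      = of_bool (covers e (2 ^ n + k) \<and> alive R' (2 ^ n + k)) * 2 ^ (n - splits R' (2 ^ n + k))"
    by simp
qed

lemma forbidden_prefix_node_iff:
  "forbidden R (prefix_node X n) \<longleftrightarrow> (\<exists>e<prefix_node X n. covers e (prefix_node X n) \<and>
    2 ^ (e + 2) * mass R e n \<le> 2 ^ n)"
  by (simp add: forbidden_def)

lemma admissible_prefix_node_iff:
  "admissible R (prefix_node X n) \<longleftrightarrow> alive R (prefix_node X n) \<and>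
     (\<forall>i\<le>n. \<not> forbidden R (prefix_node X i))"
proof -
  have "0 < prefix_node X n" using prefix_node_ge[of n X] by (auto intro: order.strict_trans2[of _ "2 ^ n"])
  then show ?thesis by (simp add: admissible_def)
qed

text \<open>Aliveness and masses at level \<open>i\<close> involve only codes below
  \<open>2 ^ i\<close>, and for levels up to that of \<open>c\<close> these are below
  \<open>c\<close>.\<close>

lemma chosen_cong:
  assumes "\<And>d. d < c \<Longrightarrow> d \<in> R \<longleftrightarrow> d \<in> R'"
  shows "chosen R c \<longleftrightarrow> chosen R' c"
proof (cases "c = 0")
  case False
  then have "0 < c" by simp
  then obtain X where X: "c = prefix_node X (floor_log c)" by (rule ex_prefix_node)
  define n where "n = floor_log c"
  have less: "d < c" if "d < 2 ^ i" "i \<le> n" for d i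
  proof -
    have "2 ^ i \<le> (2::nat) ^ n" using that(2) by (intro power_increasing) auto
    with that(1) floor_log_exp2_le[OF \<open>0 < c\<close>] show ?thesis unfolding n_def by linarith
  qed
  have "alive R c \<longleftrightarrow> alive R' c"
    by (intro alive_splits_cong(1) \<open>0 < c\<close> assms less[of _ n]) (simp_all add: n_def)
  moreover have "forbidden R (prefix_node X i) \<longleftrightarrow> forbidden R' (prefix_node X i)" if "i \<le> n" for i
  proof -
    have "mass R e i = mass R' e i" for e
      by (intro mass_cong assms less[OF _ that])
    then show ?thesis by (simp add: forbidden_prefix_node_iff)
  qed
  ultimately have "admissible R c \<longleftrightarrow> admissible R' c"
    using X[folded n_def] by (simp add: admissible_prefix_node_iff)
  with assms show ?thesis by (auto simp: chosen_def)
qed (simp add: chosen_def admissible_def)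

text \<open>Bit \<open>c\<close> is still clear at stage \<open>c\<close>, so adding
  \<open>2 ^ c\<close> inserts exactly the element \<open>c\<close>.\<close>

lemma set_decode_history: "set_decode (history c) = splitting \<inter> {..<c}"
proof (induction c)
  case (Suc c)
  have "c \<notin> set_decode (history c)" using Suc by simp
  then have "set_decode (history (Suc c))
      = (if c \<in> splitting then insert c (set_decode (history c)) else set_decode (history c))"
    by (simp add: history_def splitting_def add.commute set_decode_plus_power_2)
  with Suc show ?case by (auto simp: less_Suc_eq)
qed (simp add: history_def)

text \<open>The self-referential equation for which the recursion was set up: a finite history may
  be replaced by the whole set.\<close>

lemma mem_splitting_iff: "c \<in> splitting \<longleftrightarrow> chosen splitting c"
proof -
  have "c \<in> splitting \<longleftrightarrow> chosen (set_decode (history c)) c"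
    by (simp only: splitting_def mem_Collect_eq)
  also have "\<dots> \<longleftrightarrow> chosen splitting c"
    by (rule chosen_cong) (simp add: set_decode_history)
  finally show ?thesis .
qed

lemma admissible_splitting: "c \<in> splitting \<Longrightarrow> admissible splitting c"
  unfolding mem_splitting_iff[of c] chosen_def by blast

section \<open>Budgets and the unique splitting node of each level\<close>

lemma covers_mono:
  assumes "covers e (prefix_node X m)" "m \<le> n"
  shows "covers e (prefix_node X n)"
proof -
  have "mono (prefix_node X)" by (intro mono_iff_le_Suc[THEN iffD2]) simp
  then have "prefix_node X m \<le> prefix_node X n" using assms(2) by (rule monoD)
  with assms show ?thesis
    unfolding covers_def by simp (metis ancestor_prefix_node le_trans order_less_le_trans)
qed

lemma splits_le_floor_log: "splits R c \<le> floor_log c"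
  using card_mono[of "{..<floor_log c}" "{..<floor_log c} \<inter> {i. ancestor c i \<in> R}"]
  by (simp add: splits_def)

text \<open>A node of level \<open>n\<close> has at most \<open>n\<close> splitting ancestors, so
  the subtraction in \<open>mass\<close> is not truncated and scaling by \<open>2 ^ n\<close> is
  exact.\<close>

lemma real_mass:
  "real (mass R e n) = 2 ^ n * measure (splitting_measure R) {X. covers e (prefix_node X n)}"
proof -
  have "measure (splitting_measure R) {X. covers e (prefix_node X n)}
      = (\<Sum>c=2^n..<2^Suc n. of_bool (covers e c) * weight R c)"
    using measure_level[of R n "{c. covers e c}"] by simp
  also have "\<dots> = (\<Sum>k<2^n. of_bool (covers e (2 ^ n + k)) * weight R (2 ^ n + k))"
    by (rule sum.reindex_bij_witness[of _ "\<lambda>k. 2 ^ n + k" "\<lambda>c. c - 2 ^ n"]) auto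
  finally have "2 ^ n * measure (splitting_measure R) {X. covers e (prefix_node X n)}
      = (\<Sum>k<2^n. 2 ^ n * (of_bool (covers e (2 ^ n + k)) * weight R (2 ^ n + k)))"
    by (simp only: sum_distrib_left)
  also have "\<dots> = (\<Sum>k<2^n. real (of_bool (covers e (2^n + k) \<and> alive R (2^n + k)) *
     2 ^ (n - splits R (2^n + k))))"
  proof (intro sum.cong refl)
    fix k :: nat assume "k \<in> {..<2 ^ n}"
    then have "floor_log (2 ^ n + k) = n" by (simp add: floor_log_level)
    then have "splits R (2 ^ n + k) \<le> n"
      using splits_le_floor_log[of R "2 ^ n + k"] by simp
    then have "(2::real) ^ (n - splits R (2 ^ n + k)) = 2 ^ n / 2 ^ splits R (2 ^ n + k)"
      by (simp add: power_diff)
    then show "2 ^ n * (of_bool (covers e (2 ^ n + k)) * weight R (2 ^ n + k))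
        = real (of_bool (covers e (2^n + k) \<and> alive R (2^n + k)) * 2 ^ (n - splits R (2^n + k)))"
      by (simp add: weight_def)
  qed
  finally show ?thesis by (simp add: mass_def)
qed

lemma measure_not_alive: "measure (splitting_measure R) {X. \<not> alive R (prefix_node X n)} = 0"
proof -
  have "(\<Sum>c=2^n..<2^Suc n. of_bool (c \<in> {c. \<not> alive R c}) * weight R c) = 0"
    by (intro sum.neutral) (auto simp: weight_def)
  then show ?thesis
    using measure_level[of R n "{c. \<not> alive R c}"] by (simp only: mem_Collect_eq)
qed

text \<open>The programs that are still within their budgets cover total mass at most
  \<open>\<Sum>e. (1/2)^(e+2) = 1/2\<close>, so something is left on every level.\<close>

lemma ex_admissible: "\<exists>X. admissible R (prefix_node X n)"
proof -
  interpret prob_space "splitting_measure R" by (rule prob_space_splitting_measure)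
  define B where "B e = {X. \<exists>m\<le>n. covers e (prefix_node X m) \<and> 2 ^ (e + 2) * mass R e m \<le> 2 ^ m}" for e
  have B_sets: "B e \<in> sets borel" for e
  proof -
    have "B e = (\<Union>m\<in>{m. m \<le> n \<and> 2 ^ (e + 2) * mass R e m \<le> 2 ^ m}. {X. covers e (prefix_node X m)})"
      by (auto simp: B_def)
    also have "\<dots> \<in> sets borel"
      using sets_prefix_node[of _ "{c. covers e c}"] by (intro sets.finite_UN) auto
    finally show ?thesis .
  qed
  have "measure (splitting_measure R) (B e) \<le> (1/2) ^ (e + 2)" for e
  proof (cases "\<exists>m\<le>n. 2 ^ (e + 2) * mass R e m \<le> 2 ^ m")
    case False
    then have "B e = {}" by (auto simp: B_def)
    then show ?thesis by simp
  next
    case True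
    define M where "M = {m. m \<le> n \<and> 2 ^ (e + 2) * mass R e m \<le> 2 ^ m}"
    have M: "finite M" "M \<noteq> {}" using True by (auto simp: M_def)
    have Max: "Max M \<in> M" by (rule Max_in[OF M])
    \<comment> \<open>Coverage grows with the level, so the last level within budget covers
      everything blocked at the earlier ones.\<close>
    have "B e \<subseteq> {X. covers e (prefix_node X (Max M))}"
      using covers_mono Max_ge[OF M(1)] by (auto simp: B_def M_def)
    then have "measure (splitting_measure R) (B e)
        \<le> measure (splitting_measure R) {X. covers e (prefix_node X (Max M))}"
      using sets_prefix_node[of _ "{c. covers e c}"] by (intro finite_measure_mono) auto
    also have "\<dots> = real (mass R e (Max M)) / 2 ^ Max M"
      by (simp add: real_mass)
    also have "2 ^ (e + 2) * mass R e (Max M) \<le> 2 ^ Max M"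
      using Max by (simp add: M_def)
    then have "real (2 ^ (e + 2) * mass R e (Max M)) \<le> real (2 ^ Max M)"
      by (simp only: of_nat_le_iff)
    then have "real (mass R e (Max M)) / 2 ^ Max M \<le> (1/2) ^ (e + 2)"
      by (simp add: field_simps power_one_over)
    finally show ?thesis .
  qed
  \<comment> \<open>A program consulted at a node of level at most \<open>n\<close> is below the
    code of that node, hence below \<open>2 ^ Suc n\<close>.\<close>
  then have "measure (splitting_measure R) (\<Union>e<2^Suc n. B e) \<le> (\<Sum>e<2^Suc n. (1/2) ^ (e + 2))"
    by (intro order.trans[OF finite_measure_subadditive_finite] sum_mono) (auto simp: B_sets)
  also have "\<dots> < 1"
  proof -
    have "(\<Sum>e<k. (1/2) ^ (e + 2)) = (1 - (1/2) ^ k) / (2::real)" for k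
      by (induction k) (auto simp: field_simps)
    moreover have "(1 - (1/2) ^ k) / 2 < (1::real)" for k
      by (simp add: order.strict_trans[of "- 1" 0])
    ultimately show ?thesis by (simp only:)
  qed
  finally have "measure (splitting_measure R)
      ({X. \<not> alive R (prefix_node X n)} \<union> (\<Union>e<2^Suc n. B e)) < 1"
    using measure_not_alive[of R n] sets_prefix_node[of n "{c. \<not> alive R c}"]
    by (intro order.strict_trans1[OF measure_Un_le]) (auto simp: B_sets)
  then have "{X. \<not> alive R (prefix_node X n)} \<union> (\<Union>e<2^Suc n. B e) \<noteq> UNIV"
    using prob_space by auto
  then obtain X where X: "alive R (prefix_node X n)" "\<And>e. e < 2 ^ Suc n \<Longrightarrow> X \<notin> B e"
    by blast
  have "\<not> forbidden R (prefix_node X i)" if "i \<le> n" for i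
  proof
    assume "forbidden R (prefix_node X i)"
    then obtain e where e: "e < prefix_node X i" "covers e (prefix_node X i)"
      "2 ^ (e + 2) * mass R e i \<le> 2 ^ i"
      by (auto simp: forbidden_prefix_node_iff)
    have "e < 2 ^ Suc n"
      using e(1) prefix_node_less_power[of i "Suc n" X] that by simp
    with X(2) e that show False by (auto simp: B_def)
  qed
  with X(1) show ?thesis by (auto simp: admissible_prefix_node_iff)
qed

text \<open>The least admissible code on the level is chosen; of two chosen codes on one level, the
  larger would violate its own minimality clause.\<close>

lemma ex1_splitting: "\<exists>!c. c \<in> splitting \<and> floor_log c = n"
proof -
  define c where "c = (LEAST c. admissible splitting c \<and> floor_log c = n)"
  obtain X where "admissible splitting (prefix_node X n)" using ex_admissible by blast
  then have "\<exists>c. admissible splitting c \<and> floor_log c = n"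
    by (intro exI[of _ "prefix_node X n"]) simp
  then have c: "admissible splitting c \<and> floor_log c = n"
    unfolding c_def by (rule LeastI_ex)
  have "floor_log d \<noteq> floor_log c" if "d < c" "d \<in> splitting" for d
    using not_less_Least[OF that(1)[unfolded c_def]] that(2) c
    by (auto simp: mem_splitting_iff[of d] chosen_def)
  with c have "c \<in> splitting"
    by (auto simp: mem_splitting_iff[of c] chosen_def)
  moreover have less: "floor_log a \<noteq> floor_log b" if "a \<in> splitting" "b \<in> splitting" "a < b" for a b
    using that(2)[unfolded mem_splitting_iff[of b] chosen_def] that(1,3) by blast
  have "a = b" if "a \<in> splitting" "b \<in> splitting" "floor_log a = floor_log b" for a b
    using less[of a b] less[of b a] that by (cases a b rule: linorder_cases) simp_all
  ultimately show ?thesis using c by (intro ex1I[of _ c]) simp_all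
qed

section \<open>Convergence of the splitting nodes\<close>

definition split_node :: "nat \<Rightarrow> nat" where
  "split_node n = (THE c. c \<in> splitting \<and> floor_log c = n)"

lemma split_node_mem: "split_node n \<in> splitting" and floor_log_split_node: "floor_log (split_node n) = n"
  using theI'[OF ex1_splitting[of n]] by (auto simp: split_node_def)

lemma split_node_eqI: "c \<in> splitting \<Longrightarrow> floor_log c = n \<Longrightarrow> c = split_node n"
  using ex1_splitting[of n] split_node_mem[of n] floor_log_split_node[of n] by blast

lemma admissible_split_node: "admissible splitting (split_node n)"
  by (rule admissible_splitting[OF split_node_mem])

definition split_seq :: "nat \<Rightarrow> cantor" where
  "split_seq n = (SOME X. prefix_node X n = split_node n)"

lemma prefix_node_split_seq: "prefix_node (split_seq n) n = split_node n"
proof -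
  have "0 < split_node n" using admissible_split_node by (simp add: admissible_def)
  then have "\<exists>X. prefix_node X n = split_node n"
    by (metis ex_prefix_node floor_log_split_node)
  then show ?thesis unfolding split_seq_def by (rule someI_ex)
qed

text \<open>The parent of the next splitting node is itself admissible, so it does not lie left of
  the current splitting node; cutting off last bits preserves this order.\<close>

lemma split_seq_mono:
  assumes "n \<le> s"
  shows "prefix_node (split_seq s) n \<le> prefix_node (split_seq (Suc s)) n"
proof -
  define X where "X = split_seq (Suc s)"
  have "admissible splitting (prefix_node X (Suc s))"
    using admissible_split_node[of "Suc s"] unfolding X_def prefix_node_split_seq .
  then have adm: "admissible splitting (prefix_node X s)"
    by (auto simp: admissible_prefix_node_iff alive_prefix_node simp del: prefix_node.simps)
  have le: "split_node s \<le> prefix_node X s"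
  proof (rule ccontr)
    assume less: "\<not> split_node s \<le> prefix_node X s"
    have "floor_log d \<noteq> s" if "d < prefix_node X s" "d \<in> splitting" for d
      using less that split_node_eqI[of d s] by auto
    with adm have "prefix_node X s \<in> splitting"
      by (simp add: chosen_def mem_splitting_iff[of "prefix_node X s"])
    then show False
      using less split_node_eqI[of "prefix_node X s" s] by simp
  qed
  have "prefix_node (split_seq s) n = split_node s div 2 ^ (s - n)"
    using prefix_node_div[of "split_seq s" n "s - n"] assms by (simp add: prefix_node_split_seq)
  also have "\<dots> \<le> prefix_node X s div 2 ^ (s - n)"
    using le by (rule div_le_mono)
  also have "\<dots> = prefix_node X n"
    using prefix_node_div[of X n "s - n"] assms by simp
  finally show ?thesis by (simp add: X_def)
qed

lemma bounded_incseq_nat_eventually_const: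
  fixes f :: "nat \<Rightarrow> nat"
  assumes "mono f" "\<And>n. f n \<le> b"
  shows "\<exists>N. \<forall>n\<ge>N. f n = f N"
proof -
  have "finite (range f)" using assms(2) by (intro finite_subset[of "range f" "{..b}"]) auto
  then obtain N where N: "f N = Max (range f)" using Max_in[of "range f"] by fastforce
  then have "f n \<le> f N" for n using \<open>finite (range f)\<close> by (auto intro: Max_ge)
  then show ?thesis using monoD[OF assms(1)] by (auto intro!: exI[of _ N] antisym)
qed

lemma ex_split_limit: "\<exists>Y. \<forall>n. \<exists>s. \<forall>t\<ge>s. prefix_node (split_seq t) n = prefix_node Y n"
proof -
  have "\<exists>y s. \<forall>t\<ge>s. prefix_node (split_seq t) n = y" for n
  proof -
    let ?f = "\<lambda>k. prefix_node (split_seq (n + k)) n"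
    have "mono ?f" using split_seq_mono[of n] by (auto simp: mono_iff_le_Suc)
    moreover have "?f k \<le> 2 ^ Suc n" for k using prefix_node_less by (rule less_imp_le)
    ultimately obtain N where "\<forall>k\<ge>N. ?f k = ?f N"
      using bounded_incseq_nat_eventually_const[of ?f] by blast
    then have "\<forall>t\<ge>n + N. prefix_node (split_seq t) n = ?f N"
      by (metis le_add_diff_inverse add_le_imp_le_left le_trans le_add1)
    then show ?thesis by blast
  qed
  then obtain y s where y: "\<And>n t. t \<ge> s n \<Longrightarrow> prefix_node (split_seq t) n = y n"
    by metis
  define Y where "Y = (\<lambda>n. odd (y (Suc n)))"
  have "prefix_node Y n = y n" for n
  proof (induction n)
    case 0
    show ?case using y[of 0 "s 0"] by simp
  next
    case (Suc n)
    \<comment> \<open>A common stage at which both lengths have settled makes the two limit prefixes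
      compatible.\<close>
    define t where "t = max (s n) (s (Suc n))"
    have "prefix_node (split_seq t) n = y n" "prefix_node (split_seq t) (Suc n) = y (Suc n)"
      using y[of n t] y[of "Suc n" t] by (simp_all only: t_def max.cobounded1 max.cobounded2)
    then have "y (Suc n) = 2 * y n + of_bool (split_seq t n)" by simp
    then show ?case using Suc by (simp add: Y_def)
  qed
  with y show ?thesis by metis
qed

definition split_limit :: cantor where
  "split_limit = (SOME Y. \<forall>n. \<exists>s. \<forall>t\<ge>s. prefix_node (split_seq t) n = prefix_node Y n)"

lemma split_seq_limit: "\<exists>s. \<forall>t\<ge>s. prefix_node (split_seq t) n = prefix_node split_limit n"
  using someI_ex[OF ex_split_limit] unfolding split_limit_def by blast

text \<open>If \<open>split_limit\<close> stopped splitting, every late splitting node would pass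
  through one of its prefixes and then be forced right wherever it goes right, hence never leave it.
  The stage \<open>s\<close> stays fixed along the way, so some splitting node would lie on
  \<open>split_limit\<close> after all.\<close>

lemma infinitely_many_splits: "\<exists>m\<ge>n. prefix_node split_limit m \<in> splitting"
proof (rule ccontr)
  assume "\<not> ?thesis"
  then have no_split: "prefix_node split_limit m \<notin> splitting" if "n \<le> m" for m
    using that by blast
  obtain s where s: "\<And>t. t \<ge> s \<Longrightarrow> prefix_node (split_seq t) n = prefix_node split_limit n"
    using split_seq_limit by blast
  have alive: "prefix_node (split_seq t) i \<in> splitting \<or> split_seq t i" if "i < t" for t i
    using admissible_split_node[of t] that
    by (simp add: prefix_node_split_seq[symmetric] admissible_prefix_node_iff alive_prefix_node)
  have agree: "\<forall>t\<ge>max s m. prefix_node (split_seq t) m = prefix_node split_limit m" if "n \<le> m" for m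
    using that
  proof (induction m rule: dec_induct)
    case base
    then show ?case using s by simp
  next
    case (step m)
    have right: "split_seq t m" if "t \<ge> max s (Suc m)" for t
      using alive[of m t] step no_split[of m] that by auto
    \<comment> \<open>A stage at which the limit has settled one bit further shows only that this
      bit is 1; the stage claimed by the induction is not raised to \<open>s'\<close>.\<close>
    obtain s' where "\<And>t. t \<ge> s' \<Longrightarrow> prefix_node (split_seq t) (Suc m) = prefix_node split_limit (Suc m)"
      using split_seq_limit by blast
    then have "split_seq (max s' (max s (Suc m))) m = split_limit m"
      unfolding prefix_node_eq_iff by simp
    with right[of "max s' (max s (Suc m))"] have "split_limit m" by simp
    with right step show ?case by simp
  qed
  define t where "t = max s n"
  have "split_node t = prefix_node split_limit t"
    using agree[of t] by (simp add: t_def prefix_node_split_seq[symmetric])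
  then show False using no_split[of t] split_node_mem[of t] by (simp add: t_def)
qed

text \<open>A splitting node on \<open>X\<close> at level \<open>m\<close> must be
  \<open>split_node m\<close>, so prefixes of \<open>X\<close> agree with settled prefixes of the
  splitting nodes.\<close>

lemma split_limit_unique:
  assumes "\<And>n. \<exists>m\<ge>n. prefix_node X m \<in> splitting"
  shows "X = split_limit"
proof
  fix n
  obtain s where s: "\<And>t. t \<ge> s \<Longrightarrow> prefix_node (split_seq t) (Suc n) = prefix_node split_limit (Suc n)"
    using split_seq_limit by blast
  obtain m where m: "m \<ge> max s (Suc n)" "prefix_node X m \<in> splitting" using assms by blast
  then have "prefix_node X m = prefix_node (split_seq m) m"
    using split_node_eqI[of "prefix_node X m" m] by (simp add: prefix_node_split_seq)
  moreover have "prefix_node (split_seq m) (Suc n) = prefix_node split_limit (Suc n)"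
    using s m(1) by simp
  ultimately show "X n = split_limit n"
    using m(1) unfolding prefix_node_eq_iff by simp
qed

lemma not_forbidden_split_limit: "\<not> forbidden splitting (prefix_node split_limit n)"
proof -
  obtain m where m: "m \<ge> n" "prefix_node split_limit m \<in> splitting"
    using infinitely_many_splits by blast
  with admissible_splitting[OF m(2)] show ?thesis
    by (simp add: admissible_prefix_node_iff)
qed

section \<open>Effectively open sets\<close>

text \<open>Translates node codes into \<open>string_code\<close>: the bits are consed from the last
  one backwards, following \<open>list_encode\<close>.\<close>

definition code_of_node :: "nat \<Rightarrow> nat" where
  "code_of_node c =
     rec_nat 0 (\<lambda>j v. Suc (prod_encode (of_bool (odd (c div 2 ^ j)), v))) (floor_log c)"

text \<open>Inversion by bounded search, a sum with at most one nonzero term; it is 0 when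
  \<open>x\<close> codes no binary string. The bound suffices because a string is no longer than its
  code.\<close>

definition node_of_code :: "nat \<Rightarrow> nat" where
  "node_of_code x = (\<Sum>c<2 ^ Suc x. c * of_bool (0 < c \<and> code_of_node c = x))"

lemma node_map_prefix: "node (map X [0..<n]) = prefix_node X n"
  by (simp add: node_def prefix_node_eq_iff)

lemma code_of_node_prefix_node: "code_of_node (prefix_node X n) = string_code (map X [0..<n])"
proof -
  have "rec_nat 0 (\<lambda>j v. Suc (prod_encode (of_bool (odd (prefix_node X n div 2 ^ j)), v))) j
      = list_encode (map of_bool (map X [n - j..<n]))" if "j \<le> n" for j
    using that
  proof (induction j)
    case (Suc j)
    have "prefix_node X n div 2 ^ j = prefix_node X (Suc (n - Suc j))"
      using prefix_node_div[of X "n - j" j] Suc.prems by (simp add: Suc_diff_Suc del: prefix_node.simps)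
    then have "odd (prefix_node X n div 2 ^ j) \<longleftrightarrow> X (n - Suc j)"
      by simp
    moreover have "[n - Suc j..<n] = (n - Suc j) # [n - j..<n]"
      using Suc.prems by (simp add: upt_conv_Cons Suc_diff_Suc)
    ultimately show ?case
      using Suc by simp
  qed simp
  from this[of n] show ?thesis
    by (simp add: code_of_node_def string_code_def)
qed

lemma code_of_node_node: "code_of_node (node \<sigma>) = string_code \<sigma>"
  using code_of_node_prefix_node[of "\<lambda>i. \<sigma> ! i" "length \<sigma>"] by (simp add: node_def map_nth)

lemma node_pos: "0 < node \<sigma>"
  using prefix_node_ge[of "length \<sigma>"] by (auto simp: node_def intro: order.strict_trans2[of _ "2 ^ length \<sigma>"])

lemma ex_node:
  assumes "0 < c"
  shows "\<exists>\<sigma>. c = node \<sigma>"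
  using ex_prefix_node[OF assms] node_map_prefix by metis

lemma length_le_list_encode: "length xs \<le> list_encode xs"
proof (induction xs)
  case (Cons x xs)
  then show ?case using le_prod_encode_2[of "list_encode xs" x] by simp
qed simp

lemma node_of_code_string_code: "node_of_code (string_code \<sigma>) = node \<sigma>"
proof -
  have "length \<sigma> \<le> string_code \<sigma>"
    using length_le_list_encode[of "map of_bool \<sigma> :: nat list"] by (simp add: string_code_def)
  then have "node \<sigma> < 2 ^ Suc (string_code \<sigma>)"
    unfolding node_def by (intro prefix_node_less_power) simp
  moreover have "0 < c \<and> code_of_node c = string_code \<sigma> \<longleftrightarrow> c = node \<sigma>" for c
    using ex_node[of c] node_pos code_of_node_node injD[OF inj_string_code] by metis
  ultimately show ?thesis
    by (simp add: node_of_code_def of_bool_def if_distrib cong: if_cong)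
qed

lemma total_recursive_code_of_node [recursive_intros]:
  assumes "total_recursive f"
  shows "total_recursive (\<lambda>x. code_of_node (f x))"
  by (rule total_recursive_compose[OF _ assms]) (unfold code_of_node_def, intro recursive_intros)

lemma total_recursive_node_of_code [recursive_intros]:
  assumes "total_recursive f"
  shows "total_recursive (\<lambda>x. node_of_code (f x))"
  by (rule total_recursive_compose[OF _ assms]) (unfold node_of_code_def, intro recursive_intros)

lemma Union_cylinder_eq: "(\<Union>\<sigma>\<in>{\<sigma>. P (node \<sigma>)}. cylinder \<sigma>) = {X. \<exists>n. P (prefix_node X n)}"
proof safe
  fix X \<sigma> assume "P (node \<sigma>)" "X \<in> cylinder \<sigma>"
  then show "\<exists>n. P (prefix_node X n)" by (metis mem_cylinder_iff)
next
  fix X n assume "P (prefix_node X n)"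
  then have "map X [0..<n] \<in> {\<sigma>. P (node \<sigma>)}" "X \<in> cylinder (map X [0..<n])"
    by (simp_all add: node_map_prefix mem_cylinder_iff)
  then show "X \<in> (\<Union>\<sigma>\<in>{\<sigma>. P (node \<sigma>)}. cylinder \<sigma>)" by blast
qed

lemma uniformly_effectively_open_decidable:
  assumes "decidable (\<lambda>z. P (pfst z) (psnd z))"
  shows "uniformly_effectively_open (\<lambda>i. {X. \<exists>n. P i (prefix_node X n)})"
proof -
  define W where "W = {(i, \<sigma>). P i (node \<sigma>)}"
  \<comment> \<open>The round trip through node codes recognizes which numbers code binary
    strings.\<close>
  have "(\<lambda>(i, \<sigma>). prod_encode (i, string_code \<sigma>)) ` W = {z. 0 < node_of_code (psnd z) \<and>
      code_of_node (node_of_code (psnd z)) = psnd z \<and> P (pfst z) (node_of_code (psnd z))}"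
    (is "?L = ?R")
  proof safe
    fix z assume z: "0 < node_of_code (psnd z)" "code_of_node (node_of_code (psnd z)) = psnd z"
      "P (pfst z) (node_of_code (psnd z))"
    then obtain \<sigma> where "node_of_code (psnd z) = node \<sigma>" using ex_node by blast
    with z have "(pfst z, \<sigma>) \<in> W" "string_code \<sigma> = psnd z"
      by (simp_all add: W_def code_of_node_node)
    then show "z \<in> ?L" by (force intro!: image_eqI[of _ _ "(pfst z, \<sigma>)"])
  qed (auto simp: W_def node_of_code_string_code node_pos code_of_node_node)
  moreover have "decidable (\<lambda>z. z \<in> ?R)"
    unfolding mem_Collect_eq by (intro recursive_intros decidable_compose2[where P = P, OF assms])
  ultimately have "comp_enumerable ((\<lambda>(i, \<sigma>). prod_encode (i, string_code \<sigma>)) ` W)"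
    using comp_enumerable_decidable[of ?R] by simp
  moreover have "{X. \<exists>n. P i (prefix_node X n)} = (\<Union>\<sigma>\<in>{\<sigma>. (i, \<sigma>) \<in> W}. cylinder \<sigma>)" for i
    using Union_cylinder_eq[of "P i"] by (simp add: W_def)
  ultimately show ?thesis
    unfolding uniformly_effectively_open_def by (intro exI[of _ W] conjI) auto
qed

text \<open>Brings every test into the input format of \<open>covers\<close>, by pulling its
  enumeration back along the translation of node codes.\<close>

lemma uniformly_effectively_open_index:
  assumes "uniformly_effectively_open U"
  shows "\<exists>e. \<forall>i. U i = {X. \<exists>n p. halts_within e (prod_encode (i, prefix_node X n)) p}"
proof -
  obtain W where W: "comp_enumerable ((\<lambda>(i, \<sigma>). prod_encode (i, string_code \<sigma>)) ` W)"
    "\<And>i. U i = (\<Union>\<sigma>\<in>{\<sigma>. (i, \<sigma>) \<in> W}. cylinder \<sigma>)"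
    using assms by (auto simp: uniformly_effectively_open_def)
  let ?A = "(\<lambda>(i, \<sigma>). prod_encode (i, string_code \<sigma>)) ` W"
  have "total_recursive (\<lambda>z. prod_encode (pfst z, code_of_node (psnd z)))"
    by (intro recursive_intros)
  from comp_enumerable_index[OF comp_enumerable_vimage[OF W(1) this]] obtain e where
    e: "\<And>z. prod_encode (pfst z, code_of_node (psnd z)) \<in> ?A \<longleftrightarrow> (\<exists>p. halts_within e z p)"
    by (auto simp: vimage_def)
  have "(i, \<sigma>) \<in> W \<longleftrightarrow> prod_encode (i, code_of_node (node \<sigma>)) \<in> ?A" for i \<sigma>
    by (force simp: code_of_node_node inj_eq[OF inj_string_code])
  then have "(i, \<sigma>) \<in> W \<longleftrightarrow> (\<exists>p. halts_within e (prod_encode (i, node \<sigma>)) p)" for i \<sigma>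
    using e[of "prod_encode (i, node \<sigma>)"] by simp
  then show ?thesis
    using W(2) Union_cylinder_eq[of "\<lambda>c. \<exists>p. halts_within e (prod_encode (_, c)) p"]
    by (intro exI[of _ e]) simp
qed

lemma open_uniformly_effectively_open: "uniformly_effectively_open U \<Longrightarrow> open (U i)"
  by (auto simp: uniformly_effectively_open_def intro!: open_UN open_cylinder)

section \<open>The measure\<close>

abbreviation \<mu>\<^sub>S :: "cantor measure" where "\<mu>\<^sub>S \<equiv> splitting_measure splitting"

lemma Inter_prefix: "(\<Inter>n. {Z. prefix_node Z n = prefix_node X n}) = {X}"
  unfolding prefix_node_eq_iff by (auto simp: fun_eq_iff)

lemma sets_singleton_cantor [measurable, simp]: "{X :: cantor} \<in> sets borel"
  unfolding Inter_prefix[symmetric] by (intro sets.countable_INT) auto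

lemma measure_prefix_limit: "(\<lambda>n. weight R (prefix_node X n)) \<longlonglongrightarrow> measure (splitting_measure R) {X}"
proof -
  interpret prob_space "splitting_measure R" by (rule prob_space_splitting_measure)
  have "decseq (\<lambda>n. {Z. prefix_node Z n = prefix_node X n})"
    unfolding decseq_def prefix_node_eq_iff by auto
  from finite_Lim_measure_decseq[OF _ this] show ?thesis
    by (simp add: image_subset_iff Inter_prefix measure_prefix_node_eq)
qed

lemma measure_singleton_le_weight: "measure (splitting_measure R) {X} \<le> weight R (prefix_node X n)"
proof -
  interpret prob_space "splitting_measure R" by (rule prob_space_splitting_measure)
  show ?thesis
    unfolding measure_prefix_node_eq[symmetric] by (rule finite_measure_mono) auto
qed

lemma splits_unbounded: "\<exists>n. k \<le> splits splitting (prefix_node split_limit n)"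
proof (induction k)
  case (Suc k)
  then obtain n where n: "k \<le> splits splitting (prefix_node split_limit n)" by blast
  obtain m where m: "m \<ge> n" "prefix_node split_limit m \<in> splitting"
    using infinitely_many_splits by blast
  have "insert m {i. i < n \<and> prefix_node split_limit i \<in> splitting}
      \<subseteq> {i. i < Suc m \<and> prefix_node split_limit i \<in> splitting}"
    using m by auto
  from card_mono[OF _ this] n m(1) show ?case
    by (auto simp: splits_prefix_node simp del: prefix_node.simps intro!: exI[of _ "Suc m"])
qed simp

lemma measure_split_limit: "measure \<mu>\<^sub>S {split_limit} = 0"
proof -
  have "measure \<mu>\<^sub>S {split_limit} \<le> (1/2) ^ k" for k
  proof -
    obtain n where "k \<le> splits splitting (prefix_node split_limit n)"
      using splits_unbounded by blast
    then have "weight splitting (prefix_node split_limit n) \<le> (1/2) ^ k"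
      unfolding weight_def power_one_over
      by (intro frac_le) (auto intro: power_increasing)
    with measure_singleton_le_weight show ?thesis by (rule order.trans)
  qed
  moreover have "(\<lambda>k. (1/2) ^ k) \<longlonglongrightarrow> (0::real)"
    by (rule LIMSEQ_realpow_zero) auto
  ultimately show ?thesis
    using LIMSEQ_le_const by (metis (no_types) measure_nonneg antisym)
qed

text \<open>An alive path other than \<open>split_limit\<close> splits finitely often, so its prefix
  weights are bounded below by a positive constant, and so is their limit.\<close>

lemma Atoms_splitting_measure:
  "Atoms \<mu>\<^sub>S = {X. X \<noteq> split_limit \<and> (\<forall>n. alive splitting (prefix_node X n))}"
proof (intro subset_antisym subsetI; unfold mem_Collect_eq)
  fix X assume "X \<in> Atoms \<mu>\<^sub>S"
  then have pos: "0 < measure \<mu>\<^sub>S {X}" by (simp add: Atoms_def)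
  then have "X \<noteq> split_limit" by (auto simp: measure_split_limit)
  moreover have "alive splitting (prefix_node X n)" for n
    using order.strict_trans2[OF pos measure_singleton_le_weight[of _ _ n]]
    by (cases "alive splitting (prefix_node X n)") (simp_all add: weight_def)
  ultimately show "X \<noteq> split_limit \<and> (\<forall>n. alive splitting (prefix_node X n))" by simp
next
  fix X assume "X \<noteq> split_limit \<and> (\<forall>n. alive splitting (prefix_node X n))"
  then have ne: "X \<noteq> split_limit" and alive: "\<forall>n. alive splitting (prefix_node X n)" by auto
  then obtain m where m: "\<And>n. n \<ge> m \<Longrightarrow> prefix_node X n \<notin> splitting"
    using split_limit_unique by blast
  have "(1/2) ^ m \<le> weight splitting (prefix_node X n)" for n
  proof -
    have "{i. i < n \<and> prefix_node X i \<in> splitting} \<subseteq> {..<m}"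
      using m by (auto simp: not_le[symmetric])
    from card_mono[OF _ this] have "splits splitting (prefix_node X n) \<le> m"
      by (simp add: splits_prefix_node)
    with alive show ?thesis
      unfolding weight_def power_one_over by (auto intro!: frac_le power_increasing)
  qed
  then have "(1/2) ^ m \<le> measure \<mu>\<^sub>S {X}"
    by (intro LIMSEQ_le_const[OF measure_prefix_limit]) auto
  then show "X \<in> Atoms \<mu>\<^sub>S"
    by (auto simp: Atoms_def intro: order.strict_trans2[of _ "(1/2) ^ m"])
qed

lemma trivial_splitting_measure: "trivial_measure \<mu>\<^sub>S"
proof -
  interpret prob_space \<mu>\<^sub>S by (rule prob_space_splitting_measure)
  let ?N = "insert split_limit (\<Union>n. {X. \<not> alive splitting (prefix_node X n)})"
  have sets: "{X. \<not> alive splitting (prefix_node X n)} \<in> sets borel" for n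
    using sets_prefix_node[of n "{c. \<not> alive splitting c}"] by simp
  have "(\<Union>n. {X. \<not> alive splitting (prefix_node X n)}) \<in> null_sets \<mu>\<^sub>S"
    using sets by (intro null_sets_UN) (auto simp: null_sets_def emeasure_eq_measure measure_not_alive)
  moreover have "{split_limit} \<in> null_sets \<mu>\<^sub>S"
    by (auto simp: null_sets_def emeasure_eq_measure measure_split_limit)
  ultimately have "?N \<in> null_sets \<mu>\<^sub>S"
    using null_sets.Un[of "{split_limit}" \<mu>\<^sub>S] by simp
  moreover have "Atoms \<mu>\<^sub>S = space \<mu>\<^sub>S - ?N"
    by (auto simp: Atoms_splitting_measure)
  ultimately show ?thesis
    using prob_compl[of ?N] by (auto simp: trivial_measure_def null_sets_def measure_def)
qed

lemma computable_splitting_measure: "computable_measure \<mu>\<^sub>S"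
proof -
  \<comment> \<open>Cylinder values are exact dyadics, so the precision is ignored; the factor 2
    appears because \<open>int_decode 2 = 1\<close>.\<close>
  define f where "f z = (let c = node_of_code (pfst z) in
    prod_encode (2 * of_bool (alive splitting c), splits splitting c))" for z
  have "total_recursive f"
    unfolding f_def Let_def by (intro recursive_intros)
  moreover have "measure \<mu>\<^sub>S (cylinder \<sigma>) = dyadic_of_code (f (prod_encode (string_code \<sigma>, i)))" for \<sigma> i
  proof -
    have "cylinder \<sigma> = {X. prefix_node X (length \<sigma>) = prefix_node (\<lambda>i. \<sigma> ! i) (length \<sigma>)}"
      by (auto simp: mem_cylinder_iff node_def)
    then have "measure \<mu>\<^sub>S (cylinder \<sigma>) = weight splitting (node \<sigma>)"
      by (simp add: measure_prefix_node_eq node_def)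
    moreover have "int_decode 2 = 1" "int_decode 0 = 0"
      by (simp_all add: int_decode_def sum_decode_def)
    ultimately show ?thesis
      by (simp add: dyadic_of_code_def f_def node_of_code_string_code weight_def)
  qed
  ultimately show ?thesis
    unfolding computable_measure_def computable_dyadic_valued_def
    by (intro exI[of _ "\<lambda>\<sigma> i. measure \<mu>\<^sub>S (cylinder \<sigma>)"]) auto
qed

section \<open>Weakly 2-random and Martin-Loef random points\<close>

lemma Atoms_subset_W2R:
  assumes "prob_space \<mu>" "sets \<mu> = sets borel"
  shows "Atoms \<mu> \<subseteq> W2R \<mu>"
proof (rule subsetI, unfold W2R_def mem_Collect_eq, intro allI impI notI)
  interpret prob_space \<mu> by fact
  fix X U assume X: "X \<in> Atoms \<mu>" and U: "generalized_martin_lof_test \<mu> U" and "X \<in> (\<Inter>i. U i)"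
  have "open (U i)" for i
    using U open_uniformly_effectively_open by (auto simp: generalized_martin_lof_test_def)
  then have "measure \<mu> {X} \<le> measure \<mu> (U i)" for i
    using \<open>X \<in> (\<Inter>i. U i)\<close> assms(2) by (intro finite_measure_mono) auto
  then have "measure \<mu> {X} \<le> 0"
    using U by (intro LIMSEQ_le_const[of "\<lambda>i. measure \<mu> (U i)"])
      (auto simp: generalized_martin_lof_test_def)
  with X show False by (simp add: Atoms_def)
qed

lemma split_limit_notin_W2R: "split_limit \<notin> W2R \<mu>\<^sub>S"
proof -
  interpret prob_space \<mu>\<^sub>S by (rule prob_space_splitting_measure)
  define U where "U i = {X. \<exists>n. i \<le> prefix_node X n \<and> prefix_node X n \<in> splitting}" for i
  have "decidable (\<lambda>z. pfst z \<le> psnd z \<and> psnd z \<in> splitting)"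
    by (intro recursive_intros)
  then have open_U: "uniformly_effectively_open U"
    unfolding U_def by (rule uniformly_effectively_open_decidable)
  have sub: "(\<Inter>i. U i) \<subseteq> {split_limit}"
  proof
    fix X assume X: "X \<in> (\<Inter>i. U i)"
    have "\<exists>m\<ge>n. prefix_node X m \<in> splitting" for n
    proof -
      obtain m where m: "2 ^ n \<le> prefix_node X m" "prefix_node X m \<in> splitting"
        using X by (auto simp: U_def)
      \<comment> \<open>A code of at least \<open>2 ^ n\<close> occurs only on level
        \<open>n\<close> or deeper, so large codes mean deep splits.\<close>
      have "(2::nat) ^ n < 2 ^ Suc m" using m(1) prefix_node_less by (rule order.strict_trans1)
      then have "n < Suc m" by (subst (asm) power_strict_increasing_iff) simp_all
      with m(2) show ?thesis by (intro exI[of _ m]) simp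
    qed
    then show "X \<in> {split_limit}" using split_limit_unique by simp
  qed
  have sets_U: "U i \<in> sets borel" for i
    using open_uniformly_effectively_open[OF open_U] by simp
  \<comment> \<open>Continuity from above gives the limit without any rate of convergence, which is
    all that a generalized test requires.\<close>
  have "(\<lambda>i. measure \<mu>\<^sub>S (U i)) \<longlonglongrightarrow> measure \<mu>\<^sub>S (\<Inter>i. U i)"
    using sets_U by (intro finite_Lim_measure_decseq) (auto simp: decseq_def U_def intro: le_trans)
  also have "measure \<mu>\<^sub>S (\<Inter>i. U i) = 0"
    using finite_measure_mono[OF sub] by (simp add: measure_split_limit antisym)
  finally have "generalized_martin_lof_test \<mu>\<^sub>S U"
    using open_U by (simp add: generalized_martin_lof_test_def)
  moreover have "split_limit \<in> U i" for i
  proof -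
    obtain m where "m \<ge> i" "prefix_node split_limit m \<in> splitting"
      using infinitely_many_splits by blast
    moreover have "m < prefix_node split_limit m"
      using prefix_node_ge less_exp by (rule order.strict_trans2[rotated])
    ultimately show ?thesis by (auto simp: U_def intro!: exI[of _ m])
  qed
  ultimately show ?thesis by (auto simp: W2R_def)
qed

lemma W2R_splitting_measure: "W2R \<mu>\<^sub>S = Atoms \<mu>\<^sub>S"
proof
  show "Atoms \<mu>\<^sub>S \<subseteq> W2R \<mu>\<^sub>S"
    by (intro Atoms_subset_W2R prob_space_splitting_measure sets_splitting_measure)
  show "W2R \<mu>\<^sub>S \<subseteq> Atoms \<mu>\<^sub>S"
  proof
    fix X assume X: "X \<in> W2R \<mu>\<^sub>S"
    have "alive splitting (prefix_node X n)" for n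
    proof (rule ccontr)
      assume not_alive: "\<not> alive splitting (prefix_node X n)"
      \<comment> \<open>The constant test formed by the single cylinder at a node that is not alive
        has measure zero and captures \<open>X\<close>.\<close>
      define U :: "nat \<Rightarrow> cantor set" where "U i = {Z. \<exists>m. prefix_node Z m = prefix_node X n}" for i
      have "decidable (\<lambda>z. psnd z = prefix_node X n)" by (intro recursive_intros)
      then have "uniformly_effectively_open U"
        unfolding U_def by (rule uniformly_effectively_open_decidable)
      moreover have "U i = {Z. prefix_node Z n = prefix_node X n}" for i
        unfolding U_def using floor_log_prefix_node by (metis (no_types))
      then have "measure \<mu>\<^sub>S (U i) = 0" for i
        using not_alive by (simp add: measure_prefix_node_eq weight_def)
      ultimately have "generalized_martin_lof_test \<mu>\<^sub>S U"
        by (simp add: generalized_martin_lof_test_def)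
      with X have "X \<notin> (\<Inter>i. U i)" by (simp add: W2R_def)
      then show False by (auto simp: U_def)
    qed
    with X split_limit_notin_W2R show "X \<in> Atoms \<mu>\<^sub>S"
      by (auto simp: Atoms_splitting_measure)
  qed
qed

lemma split_limit_in_MLR: "split_limit \<in> MLR \<mu>\<^sub>S"
  unfolding MLR_def mem_Collect_eq
proof (intro allI impI notI)
  interpret prob_space \<mu>\<^sub>S by (rule prob_space_splitting_measure)
  fix V assume V: "martin_lof_test \<mu>\<^sub>S V" and Y: "split_limit \<in> (\<Inter>i. V i)"
  then have eff: "uniformly_effectively_open V" by (simp add: martin_lof_test_def)
  obtain e where e: "\<And>i. V i = {X. \<exists>n p. halts_within e (prod_encode (i, prefix_node X n)) p}"
    using uniformly_effectively_open_index[OF eff] by blast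
  from Y have "split_limit \<in> V (e + 2)" by blast
  then obtain n p where np: "halts_within e (prod_encode (e + 2, prefix_node split_limit n)) p"
    unfolding e by blast
  \<comment> \<open>Level \<open>m\<close> reaches the enumerated prefix, and its node code exceeds
    \<open>m\<close>, hence both the certificate \<open>p\<close> and the index
    \<open>e\<close>.\<close>
  define m where "m = max n (max p e)"
  have "m < prefix_node split_limit m"
    using prefix_node_ge less_exp by (rule order.strict_trans2[rotated])
  then have less: "p < prefix_node split_limit m" "e < prefix_node split_limit m"
    by (simp_all add: m_def)
  have "n \<le> m" by (simp add: m_def)
  then have cov: "covers e (prefix_node split_limit m)"
    unfolding covers_def using np less(1) by (intro exI[of _ n] conjI exI[of _ p]) simp_all
  \<comment> \<open>What is seen covered lies in component \<open>e + 2\<close> of a genuine test,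
    so program \<open>e\<close> is within budget at every level and its veto counts.\<close>
  have "{X. covers e (prefix_node X m)} \<subseteq> V (e + 2)"
    by (auto simp: covers_def e) blast
  then have "measure \<mu>\<^sub>S {X. covers e (prefix_node X m)} \<le> measure \<mu>\<^sub>S (V (e + 2))"
    using open_uniformly_effectively_open[OF eff] by (intro finite_measure_mono) simp_all
  also have "\<dots> \<le> (1/2) ^ (e + 2)"
    using V by (simp only: martin_lof_test_def)
  finally have "real (mass splitting e m) \<le> 2 ^ m * (1/2) ^ (e + 2)"
    by (simp add: real_mass)
  then have "real (2 ^ (e + 2) * mass splitting e m) \<le> real (2 ^ m)"
    by (simp add: field_simps power_one_over)
  then have "2 ^ (e + 2) * mass splitting e m \<le> 2 ^ m"
    by (simp only: of_nat_le_iff)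
  with cov less(2) have "forbidden splitting (prefix_node split_limit m)"
    by (auto simp: forbidden_prefix_node_iff)
  then show False using not_forbidden_split_limit by blast
qed

theorem theorem4p3:
  shows "\<exists>\<mu> :: cantor measure.
    prob_space \<mu> \<and> sets \<mu> = sets borel \<and> computable_measure \<mu> \<and> trivial_measure \<mu> \<and>
    W2R \<mu> = Atoms \<mu> \<and> MLR \<mu> - W2R \<mu> \<noteq> {}"
  using prob_space_splitting_measure sets_splitting_measure computable_splitting_measure
    trivial_splitting_measure W2R_splitting_measure split_limit_in_MLR split_limit_notin_W2R
  by (intro exI[of _ \<mu>\<^sub>S]) blast

end
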